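(* Let $\zeta$ denote the Riemann zeta-function. The set $$\{(\zeta(\tfrac12+it),\ \zeta'(\tfrac12+it)) : t\in\mathbb{R}\}$$ is not dense in $\mathbb{C}^2$. *)

theory Defs
  imports "HOL-Complex_Analysis.Complex_Analysis"
begin

text \<open>
  The Riemann zeta-function is the analytic continuation of its Dirichlet series to the complex
  plane without the point 1. The value 0 at the pole is a convention that makes the total
  function unique. Existence and uniqueness are proved as \<open>ex1_is_zeta\<close>, and the
  characterization of \<open>zeta\<close> itself is \<open>is_zeta_zeta\<close>.
\<close>

definition is_zeta :: "(complex \<Rightarrow> complex) \<Rightarrow> bool" where
  "is_zeta f \<longleftrightarrow> f holomorphic_on (- {1}) \<and> f 1 = 0 \<and>
     (\<forall>s. Re s > 1 \<longrightarrow> (\<lambda>n. of_nat (Suc n) powr (- s)) sums f s)"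

definition zeta :: "complex \<Rightarrow> complex" where
  "zeta = (THE f. is_zeta f)"

lemma is_zeta_unique:
  assumes f: "is_zeta f" and g: "is_zeta g"
  shows "f = g"
proof
  fix s
  show "f s = g s"
  proof (cases "s = 1")
    case True
    then show ?thesis using f g by (simp add: is_zeta_def)
  next
    case False
    have eq: "f z = g z" if "z \<in> {z. Re z > 1}" for z
      using that f g sums_unique2 unfolding is_zeta_def by blast
    have "connected (- {1 :: complex})"
      by (rule connected_punctured_universe) simp
    moreover have "{z. Re z > 1} \<noteq> {}"
      by (auto intro: exI[of _ 2])
    moreover have "open {z. Re z > 1}" by (rule open_halfspace_Re_gt)
    ultimately show ?thesis
      using analytic_continuation_open[of "{z. Re z > 1}" "- {1}" f g s] f g eq False
      unfolding is_zeta_def by auto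
  qed
qed

lemma holomorphic_comparison_series:
  fixes f :: "nat \<Rightarrow> complex \<Rightarrow> complex" and C :: "complex \<Rightarrow> real" and a :: real
  assumes hol: "\<And>n. f n holomorphic_on {s. Re s > a}"
    and C: "continuous_on UNIV C"
    and bound: "\<And>n s. Re s > a \<Longrightarrow> norm (f n s) \<le> C s * real (Suc n) powr (- (Re s - a + 1))"
  shows "\<exists>g. g holomorphic_on {s. Re s > a} \<and> (\<forall>s. Re s > a \<longrightarrow> (\<lambda>n. f n s) sums g s)"
proof -
  let ?S = "{s. Re s > a}"
  have S: "open ?S" by (rule open_halfspace_Re_gt)
  have dif: "f n field_differentiable (at x)" if "x \<in> ?S" for n x
    using hol S that holomorphic_on_imp_differentiable_at by blast
  have loc: "\<exists>d h. 0 < d \<and> summable h \<and> range h \<subseteq> \<real>\<^sub>\<ge>\<^sub>0 \<and>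
      (\<forall>\<^sub>F n in sequentially. \<forall>y\<in>ball x d \<inter> ?S. cmod (f n y) \<le> cmod (h n))"
    if x: "x \<in> ?S" for x
  proof -
    define d where "d = (Re x - a) / 2"
    have d: "d > 0" using x by (simp add: d_def)
    have "bounded (C ` cball x d)"
      by (intro compact_imp_bounded compact_continuous_image continuous_on_subset[OF C]) auto
    then obtain B where B: "\<And>y. y \<in> cball x d \<Longrightarrow> \<bar>C y\<bar> \<le> B"
      unfolding bounded_iff by fastforce
    have B0: "B \<ge> 0" using B[of x] d by auto
    define h where "h n = complex_of_real (B * real (Suc n) powr (- (1 + d)))" for n
    have "summable (\<lambda>n. real n powr (- (1 + d)))"
      using d by (subst summable_real_powr_iff) auto
    then have "summable (\<lambda>n. real (Suc n) powr (- (1 + d)))"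
      by (subst summable_Suc_iff)
    then have "summable h"
      unfolding h_def by (intro summable_of_real summable_mult)
    moreover have "range h \<subseteq> \<real>\<^sub>\<ge>\<^sub>0"
      using B0 by (auto simp: h_def nonneg_Reals_of_real_iff simp del: of_real_mult)
    moreover have "cmod (f n y) \<le> cmod (h n)" if y: "y \<in> ball x d \<inter> ?S" for n y
    proof -
      have "\<bar>Re (x - y)\<bar> < d"
        using y abs_Re_le_cmod[of "x - y"] by (auto simp: dist_norm)
      then have Re: "1 + d \<le> Re y - a + 1"
        by (auto simp: d_def field_simps abs_if split: if_splits)
      have "cmod (f n y) \<le> C y * real (Suc n) powr (- (Re y - a + 1))"
        using bound y by auto
      also have "\<dots> \<le> B * real (Suc n) powr (- (1 + d))"
      proof (intro mult_mono)
        show "C y \<le> B" using B[of y] y by auto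
        show "real (Suc n) powr (- (Re y - a + 1)) \<le> real (Suc n) powr (- (1 + d))"
          using Re by (intro powr_mono) auto
      qed (use B0 in auto)
      also have "\<dots> = cmod (h n)"
        using B0 unfolding h_def norm_of_real by simp
      finally show ?thesis .
    qed
    ultimately show ?thesis using d by (intro exI[of _ d] exI[of _ h]) auto
  qed
  obtain g where g: "\<forall>x \<in> ?S. ((\<lambda>n. f n x) sums g x) \<and> g field_differentiable (at x)"
    using series_differentiable_comparison_complex[OF S dif loc] by metis
  then have "g holomorphic_on ?S"
    by (auto simp: holomorphic_on_def intro: field_differentiable_at_within)
  with g show ?thesis by blast
qed

definition taylor_coeff :: "nat \<Rightarrow> complex \<Rightarrow> complex" where
  "taylor_coeff i s = (\<Prod>j<i. 1 - s - of_nat j)"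

text \<open>The remainder of the Taylor expansion of \<open>x powr (1 - s)\<close> at \<open>n + 1\<close>, taken at \<open>n + 2\<close>.\<close>
definition taylor_rem :: "nat \<Rightarrow> nat \<Rightarrow> complex \<Rightarrow> complex" where
  "taylor_rem N n s = of_nat (Suc (Suc n)) powr (1 - s) -
     (\<Sum>i\<le>N. taylor_coeff i s * of_nat (Suc n) powr (1 - s - of_nat i) / fact i)"

lemma norm_nat_powr: "norm ((of_nat (Suc n) :: complex) powr s) = real (Suc n) powr Re s"
proof -
  have "norm ((complex_of_real (real (Suc n))) powr s) = real (Suc n) powr Re s"
    by (subst norm_powr_real_powr) auto
  then show ?thesis by simp
qed

lemma taylor_coeff_holomorphic: "taylor_coeff i holomorphic_on A"
  unfolding taylor_coeff_def by (intro holomorphic_intros)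

lemma taylor_rem_holomorphic: "taylor_rem N n holomorphic_on A"
proof -
  have "(\<lambda>s. of_nat (Suc (Suc n)) powr (1 - s) -
     (\<Sum>i\<le>N. taylor_coeff i s * of_nat (Suc n) powr (1 - s - of_nat i) / fact i)) holomorphic_on A"
    by (intro holomorphic_intros taylor_coeff_holomorphic) (auto simp del: of_nat_Suc)
  then show ?thesis unfolding taylor_rem_def .
qed

lemma taylor_rem_bound:
  assumes "Re s + real N \<ge> 0"
  shows "norm (taylor_rem N n s) \<le> norm (taylor_coeff (Suc N) s) * real (Suc n) powr (- (Re s + real N))"
proof -
  define S where "S = complex_of_real ` {real (Suc n)..real (Suc (Suc n))}"
  define p where "p i x = taylor_coeff i s * x powr (1 - s - of_nat i)" for i x
  define B where "B = norm (taylor_coeff (Suc N) s) * real (Suc n) powr (- (Re s + real N))"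
  have "norm (p 0 (of_nat (Suc (Suc n))) - (\<Sum>i\<le>N. p i (of_nat (Suc n)) *
          (of_nat (Suc (Suc n)) - of_nat (Suc n)) ^ i / (fact i)))
        \<le> B * norm (of_nat (Suc (Suc n)) - of_nat (Suc n) :: complex) ^ (Suc N) / fact N"
  proof (rule complex_Taylor)
    show "convex S" unfolding S_def
      by (intro convex_linear_image bounded_linear.linear bounded_linear_of_real) auto
    show "of_nat (Suc n) \<in> S" unfolding S_def
      by (rule image_eqI[of _ _ "real (Suc n)"]) auto
    show "of_nat (Suc (Suc n)) \<in> S" unfolding S_def
      by (rule image_eqI[of _ _ "real (Suc (Suc n))"]) auto
  next
    fix i x assume "x \<in> S"
    then have x: "x \<notin> \<real>\<^sub>\<le>\<^sub>0" unfolding S_def by (auto simp: complex_nonpos_Reals_iff)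
    show "(p i has_field_derivative p (Suc i) x) (at x within S)"
      unfolding p_def using x
      by (auto intro!: derivative_eq_intros simp: taylor_coeff_def algebra_simps)
  next
    fix x assume "x \<in> S"
    then obtain y where y: "x = of_real y" "y \<ge> real (Suc n)" unfolding S_def by auto
    have "norm (x powr (1 - s - of_nat (Suc N))) = y powr (- (Re s + real N))"
      using y by (subst y(1), subst norm_powr_real_powr) auto
    also have "\<dots> \<le> real (Suc n) powr (- (Re s + real N))"
      using assms y by (intro powr_mono2') auto
    finally show "norm (p (Suc N) x) \<le> B"
      unfolding p_def B_def norm_mult by (rule mult_left_mono) auto
  qed
  also have "\<dots> \<le> B"
  proof -
    have "B \<ge> 0" by (simp add: B_def)
    then have "B / fact N \<le> B / 1"
      by (intro divide_left_mono fact_ge_1) auto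
    then show ?thesis by simp
  qed
  finally show ?thesis
    by (simp add: p_def B_def taylor_rem_def taylor_coeff_def)
qed

lemma taylor_rem_series:
  assumes "N \<ge> 1"
  shows "\<exists>g. g holomorphic_on {s. Re s > 1 - real N} \<and>
           (\<forall>s. Re s > 1 - real N \<longrightarrow> (\<lambda>n. taylor_rem N n s) sums g s)"
proof (rule holomorphic_comparison_series)
  show "continuous_on UNIV (\<lambda>s. norm (taylor_coeff (Suc N) s))"
    by (intro continuous_on_norm holomorphic_on_imp_continuous_on taylor_coeff_holomorphic)
next
  fix n s assume "Re s > 1 - real N"
  then show "norm (taylor_rem N n s) \<le>
      norm (taylor_coeff (Suc N) s) * real (Suc n) powr (- (Re s - (1 - real N) + 1))"
    using taylor_rem_bound[of s N n] by (simp add: algebra_simps)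
qed (rule taylor_rem_holomorphic)

lemma dirichlet_series:
  "\<exists>g. g holomorphic_on {s. Re s > 1} \<and>
       (\<forall>s. Re s > 1 \<longrightarrow> (\<lambda>n. of_nat (Suc n) powr (- s)) sums g s)"
proof (rule holomorphic_comparison_series[where C = "\<lambda>_. 1"])
  show "(\<lambda>s. of_nat (Suc n) powr (- s)) holomorphic_on {s. Re s > 1}" for n
    by (intro holomorphic_intros) (auto simp del: of_nat_Suc)
qed (auto simp: norm_nat_powr simp del: of_nat_Suc)

lemma nat_powr_tendsto_0:
  assumes "Re s > 1"
  shows "(\<lambda>n. (of_nat (Suc n) :: complex) powr (1 - s)) \<longlonglongrightarrow> 0"
proof (rule tendsto_norm_zero_cancel)
  have "(\<lambda>n. real (Suc n) powr (1 - Re s)) \<longlonglongrightarrow> 0"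
    using assms by real_asymp
  then show "(\<lambda>n. norm ((of_nat (Suc n) :: complex) powr (1 - s))) \<longlonglongrightarrow> 0"
    by (simp add: norm_nat_powr del: of_nat_Suc)
qed

lemma taylor_rem_sums:
  assumes s: "Re s > 1"
    and Z: "\<And>s. Re s > 1 \<Longrightarrow> (\<lambda>n. of_nat (Suc n) powr (- s)) sums Z s"
  shows "(\<lambda>n. taylor_rem N n s) sums
           (- 1 - (\<Sum>i=1..N. taylor_coeff i s * Z (s + of_nat i - 1) / fact i))"
proof -
  have "(\<lambda>n. of_nat (Suc (Suc n)) powr (1 - s) - of_nat (Suc n) powr (1 - s)) sums
      (0 - of_nat (Suc 0) powr (1 - s))"
    by (rule telescope_sums[OF nat_powr_tendsto_0[OF s]])
  moreover have "(\<lambda>n. \<Sum>i=1..N. taylor_coeff i s * of_nat (Suc n) powr (- (s + of_nat i - 1)) / fact i)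
      sums (\<Sum>i=1..N. taylor_coeff i s * Z (s + of_nat i - 1) / fact i)"
    using s by (intro sums_sum sums_divide sums_mult Z) auto
  ultimately have "(\<lambda>n. (of_nat (Suc (Suc n)) powr (1 - s) - of_nat (Suc n) powr (1 - s)) -
      (\<Sum>i=1..N. taylor_coeff i s * of_nat (Suc n) powr (- (s + of_nat i - 1)) / fact i)) sums
      ((0 - of_nat (Suc 0) powr (1 - s)) - (\<Sum>i=1..N. taylor_coeff i s * Z (s + of_nat i - 1) / fact i))"
    by (rule sums_diff)
  moreover have "(of_nat (Suc (Suc n)) powr (1 - s) - of_nat (Suc n) powr (1 - s)) -
      (\<Sum>i=1..N. taylor_coeff i s * of_nat (Suc n) powr (- (s + of_nat i - 1)) / fact i) =
      taylor_rem N n s" for n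
  proof -
    have "{..N} = insert 0 {1..N}" by auto
    then show ?thesis
      unfolding taylor_rem_def by (simp add: taylor_coeff_def algebra_simps del: of_nat_Suc)
  qed
  ultimately show ?thesis by simp
qed

lemma zeta_strip_continuation:
  assumes Z: "\<And>s. Re s > 1 \<Longrightarrow> (\<lambda>n. of_nat (Suc n) powr (- s)) sums Z s"
    and holZ: "Z holomorphic_on {s. Re s > 1}"
  shows "\<exists>G. G holomorphic_on {s. Re s > 1 - real m} \<and> (\<forall>s. Re s > 1 \<longrightarrow> G s = (s - 1) * Z s)"
proof (induction m)
  case 0
  have "(\<lambda>s. (s - 1) * Z s) holomorphic_on {s. Re s > 1}"
    by (intro holomorphic_intros holZ)
  then show ?case by (intro exI[of _ "\<lambda>s. (s - 1) * Z s"]) auto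
next
  case (Suc m)
  then obtain G where G: "G holomorphic_on {s. Re s > 1 - real m}"
    and GZ: "\<And>s. Re s > 1 \<Longrightarrow> G s = (s - 1) * Z s" by blast
  obtain R where R: "R holomorphic_on {s. Re s > 1 - real (Suc m)}"
    and Rs: "\<And>s. Re s > 1 - real (Suc m) \<Longrightarrow> (\<lambda>n. taylor_rem (Suc m) n s) sums R s"
    using taylor_rem_series[of "Suc m"] by auto
  define H where "H s = 1 - (\<Sum>i=2..Suc m. taylor_coeff (i - 1) s * G (s + of_nat i - 1) / fact i) + R s" for s
  have "(\<lambda>s. G (s + of_nat i - 1)) holomorphic_on {s. Re s > 1 - real (Suc m)}"
    if "i \<in> {2..Suc m}" for i
  proof -
    have "(G \<circ> (\<lambda>s. s + of_nat i - 1)) holomorphic_on {s. Re s > 1 - real (Suc m)}"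
      by (rule holomorphic_on_compose_gen[OF _ G]) (use that in \<open>auto intro!: holomorphic_intros\<close>)
    then show ?thesis by (simp add: o_def)
  qed
  then have "H holomorphic_on {s. Re s > 1 - real (Suc m)}"
    unfolding H_def by (intro holomorphic_intros R taylor_coeff_holomorphic) auto
  moreover have "H s = (s - 1) * Z s" if s: "Re s > 1" for s
  proof -
    have "R s = - 1 - (\<Sum>i=1..Suc m. taylor_coeff i s * Z (s + of_nat i - 1) / fact i)"
      using s by (intro sums_unique2[OF Rs taylor_rem_sums[OF s Z]]) auto
    also have "{1..Suc m} = insert 1 {2..Suc m}" by auto
    also have "(\<Sum>i\<in>insert 1 {2..Suc m}. taylor_coeff i s * Z (s + of_nat i - 1) / fact i) =
        (1 - s) * Z s + (\<Sum>i=2..Suc m. taylor_coeff i s * Z (s + of_nat i - 1) / fact i)"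
      by (subst sum.insert) (auto simp: taylor_coeff_def)
    also have "(\<Sum>i=2..Suc m. taylor_coeff i s * Z (s + of_nat i - 1) / fact i) =
        (\<Sum>i=2..Suc m. - (taylor_coeff (i - 1) s * G (s + of_nat i - 1) / fact i))"
    proof (rule sum.cong)
      fix i assume i: "i \<in> {2..Suc m}"
      then obtain k where k: "i = Suc k" by (cases i) auto
      have Gi: "G (s + of_nat i - 1) = (s + of_nat i - 1 - 1) * Z (s + of_nat i - 1)"
        using s i by (intro GZ) auto
      have "taylor_coeff i s = - (taylor_coeff (i - 1) s * (s + of_nat i - 1 - 1))"
        by (simp add: k taylor_coeff_def algebra_simps)
      then show "taylor_coeff i s * Z (s + of_nat i - 1) / fact i =
          - (taylor_coeff (i - 1) s * G (s + of_nat i - 1) / fact i)"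
        unfolding Gi by (simp only: minus_mult_left[symmetric] mult.assoc minus_divide_left[symmetric])
    qed auto
    finally show ?thesis
      by (simp add: H_def sum_negf algebra_simps)
  qed
  ultimately show ?case by blast
qed

lemma is_zeta_exists: "\<exists>f. is_zeta f"
proof -
  obtain Z where holZ: "Z holomorphic_on {s. Re s > 1}"
    and Z: "\<And>s. Re s > 1 \<Longrightarrow> (\<lambda>n. of_nat (Suc n) powr (- s)) sums Z s"
    using dirichlet_series by blast
  obtain G where G: "\<And>m. G m holomorphic_on {s. Re s > 1 - real m}"
    and GZ: "\<And>m s. Re s > 1 \<Longrightarrow> G m s = (s - 1) * Z s"
    using zeta_strip_continuation[OF Z holZ] by metis
  have agree: "G m s = G n s" if "m \<le> n" "Re s > 1 - real m" for m n s
  proof (rule analytic_continuation_open[of "{s. Re s > 1}" "{s. Re s > 1 - real m}" "G m" "G n" s])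
    show "{s. Re s > 1} \<noteq> {}" by (auto intro: exI[of _ 2])
    show "connected {s. Re s > 1 - real m}"
      by (intro convex_connected convex_halfspace_Re_gt)
    show "G n holomorphic_on {s. Re s > 1 - real m}"
      by (rule holomorphic_on_subset[OF G]) (use that in auto)
    show "G m z = G n z" if "z \<in> {s. Re s > 1}" for z
      using that GZ[of z m] GZ[of z n] by simp
    show "{s. Re s > 1} \<subseteq> {s. Re s > 1 - real m}" by auto
    show "s \<in> {s. Re s > 1 - real m}" using that by simp
  qed (intro G open_halfspace_Re_gt)+
  define idx where "idx s = nat \<lceil>2 - Re s\<rceil>" for s
  have idx: "Re s > 1 - real (idx s)" for s
    unfolding idx_def by linarith
  define E where "E s = G (idx s) s" for s
  have E: "E s = G m s" if "Re s > 1 - real m" for m s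
    unfolding E_def using agree[of m "idx s" s] agree[of "idx s" m s] that idx[of s]
    by (metis nle_le)
  have E_hol: "E holomorphic_on UNIV"
  proof -
    have "E field_differentiable (at s)" for s
    proof -
      have "E holomorphic_on {z. Re z > 1 - real (idx s)}"
        by (rule holomorphic_transform[OF G]) (rule E[symmetric], simp)
      then show ?thesis
        using idx[of s] by (intro holomorphic_on_imp_differentiable_at[OF _ open_halfspace_Re_gt]) auto
    qed
    then show ?thesis by (auto simp: holomorphic_on_def)
  qed
  define f where "f s = (if s = 1 then 0 else E s / (s - 1))" for s
  have "(\<lambda>s. E s / (s - 1)) holomorphic_on (- {1})"
    by (intro holomorphic_intros holomorphic_on_subset[OF E_hol]) auto
  then have "f holomorphic_on (- {1})"
    by (rule holomorphic_transform) (auto simp: f_def)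
  moreover have "f s = Z s" if "Re s > 1" for s
    using that E[of 0 s] GZ[of s 0] by (auto simp: f_def)
  ultimately have "is_zeta f"
    using Z by (auto simp: is_zeta_def f_def)
  then show ?thesis by blast
qed

lemma ex1_is_zeta: "\<exists>!f. is_zeta f"
  using is_zeta_exists is_zeta_unique by blast

lemma is_zeta_zeta: "is_zeta zeta"
  unfolding zeta_def by (rule theI'[OF ex1_is_zeta])

end

(*
  On the critical line the functional equation reads zeta s = chi s * cnj (zeta s) with |chi s| = 1;
  taking logarithmic derivatives gives
    2 Re (zeta' s / zeta s) = ln (2 pi) + Re (pi/2 tan (pi s / 2)) - Re (Digamma s),
  where |tan (pi s / 2)| = 1 and Re (Digamma s) tends to infinity with |Im s|.  Hence the points of
  the curve near (1, 0) have bounded t, and there the values zeta s only fill the C^1 image of a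
  compact segment, a null set of the plane.

  The functional equation comes from the Mellin transform, for s = -a with 0 < a < 1, of
    1 / (exp x - 1) - 1 / x + 1 / 2 = sum_n 2 x / (x^2 + (2 pi n)^2):
  integrating the right-hand side termwise yields zeta (1 + a), while expanding the left-hand
  side in powers of exp (- x) yields the Euler-Maclaurin limit for zeta (- a).  All integrands are
  nonnegative, so Tonelli and monotone convergence suffice; the identity theorem does the rest.
*)

theory Submission
  imports Defs
begin

section \<open>Integrals of Mellin type\<close>

lemma nn_integral_Gamma_scaled:
  fixes a y :: real
  assumes a: "a > 0" and y: "y > 0"
  shows "(\<integral>\<^sup>+x\<in>{0<..}. ennreal (x powr (a - 1) * exp (- (y * x))) \<partial>lborel) =
      ennreal (Gamma a * y powr (- a))"
proof -
  have "ennreal (Gamma a) = (\<integral>\<^sup>+t. ennreal (indicator {0..} t * t powr (a - 1) / exp t) \<partial>lborel)"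
    by (rule Gamma_conv_nn_integral_real[OF a])
  also have "\<dots> = ennreal \<bar>y\<bar>
      * (\<integral>\<^sup>+x. ennreal (indicator {0..} (0 + y * x) * (0 + y * x) powr (a - 1) / exp (0 + y * x))
      \<partial>lborel)"
    using y by (intro nn_integral_real_affine) auto
  also have "(\<integral>\<^sup>+x. ennreal (indicator {0..} (0 + y * x)
      * (0 + y * x) powr (a - 1) / exp (0 + y * x)) \<partial>lborel) =
      (\<integral>\<^sup>+x. ennreal (y powr (a - 1))
          * (ennreal (x powr (a - 1) * exp (- (y * x))) * indicator {0<..} x) \<partial>lborel)"
    using y by (intro nn_integral_cong)
      (auto simp: indicator_def powr_mult exp_minus field_simps zero_le_mult_iff simp flip:
          ennreal_mult')
  also have "\<dots> = ennreal (y powr (a - 1))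
      * (\<integral>\<^sup>+x\<in>{0<..}. ennreal (x powr (a - 1) * exp (- (y * x))) \<partial>lborel)"
    by (rule nn_integral_cmult) measurable
  finally have "ennreal (Gamma a) =
      ennreal (y powr a) * (\<integral>\<^sup>+x\<in>{0<..}. ennreal (x powr (a - 1) * exp (- (y * x))) \<partial>lborel)"
    using y by (simp add: powr_diff mult.assoc[symmetric] flip: ennreal_mult')
  then have "ennreal (y powr (- a)) * ennreal (Gamma a) =
      ennreal (y powr (- a) * y powr a)
          * (\<integral>\<^sup>+x\<in>{0<..}. ennreal (x powr (a - 1) * exp (- (y * x))) \<partial>lborel)"
    by (simp add: ennreal_mult' mult.assoc)
  also have "y powr (- a) * y powr a = 1"
    using y by (simp flip: powr_add)
  finally show ?thesis
    using a by (simp add: mult.commute[of "Gamma a"] ennreal_mult')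
qed

text \<open>Since \<open>H x y\<close> is the integral of \<open>h x u\<close> over u from 0 to y,
  Tonelli lets the x-integral be done first; a power of u is then integrated in u. Each application
  raises the power by one, which carries a Gamma integral to exponents where it diverges at 0 unless
  Taylor terms are subtracted.\<close>

lemma nn_integral_antiderivative_param:
  fixes h H :: "real \<Rightarrow> real \<Rightarrow> real"
  assumes meas: "(\<lambda>(x, u). h x u) \<in> borel_measurable (lborel \<Otimes>\<^sub>M lborel)"
    and nonneg: "\<And>x u. x > 0 \<Longrightarrow> u \<ge> 0 \<Longrightarrow> h x u \<ge> 0"
    and deriv: "\<And>x u. x > 0 \<Longrightarrow> u \<ge> 0 \<Longrightarrow> (H x has_real_derivative h x u) (at u)"
    and H0: "\<And>x. x > 0 \<Longrightarrow> H x 0 = 0"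
    and int: "\<And>u. u > 0 \<Longrightarrow> (\<integral>\<^sup>+x\<in>{0<..}. ennreal (h x u) \<partial>lborel) = ennreal (C * u powr (p - 1))"
    and p: "p > 0" and C: "C \<ge> 0" and y: "y \<ge> 0"
  shows "(\<integral>\<^sup>+x\<in>{0<..}. ennreal (H x y) \<partial>lborel) = ennreal (C * y powr p / p)"
proof -
  note [measurable] = meas[unfolded case_prod_beta]
  have "(\<integral>\<^sup>+x\<in>{0<..}. ennreal (H x y) \<partial>lborel) =
      (\<integral>\<^sup>+x. (\<integral>\<^sup>+u. ennreal (h x u) * indicator {0..y} u * indicator {0<..} x \<partial>lborel) \<partial>lborel)"
  proof (rule nn_integral_cong)
    fix x :: real
    show "ennreal (H x y) * indicator {0<..} x =
        (\<integral>\<^sup>+u. ennreal (h x u) * indicator {0..y} u * indicator {0<..} x \<partial>lborel)"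
    proof (cases "x > 0")
      case True
      have "(\<lambda>u. h x u) \<in> borel_measurable borel"
        using measurable_compose[OF measurable_Pair1' meas, of x] by simp
      then have "(\<integral>\<^sup>+u. ennreal (h x u) * indicator {0..y} u \<partial>lborel) = ennreal (H x y - H x 0)"
        using True y by (intro nn_integral_FTC_Icc) (auto intro: deriv nonneg)
      then show ?thesis using True H0 by simp
    qed simp
  qed
  also have "\<dots> = (\<integral>\<^sup>+u. (\<integral>\<^sup>+x. ennreal (h x u) * indicator {0..y} u * indicator {0<..} x \<partial>lborel)
      \<partial>lborel)"
    by (rule lborel_pair.Fubini'[symmetric]) measurable
  also have "\<dots> = (\<integral>\<^sup>+u. ennreal (C * u powr (p - 1)) * indicator {0..y} u \<partial>lborel)"
  proof (rule nn_integral_cong_AE)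
    \<comment> \<open>\<open>int\<close> is assumed only for \<open>u > 0\<close>; the endpoint 0 is
      a null set.\<close>
    have "AE u in lborel. u \<noteq> (0::real)" by (rule AE_lborel_singleton)
    then show "AE u in lborel.
        (\<integral>\<^sup>+x. ennreal (h x u) * indicator {0..y} u * indicator {0<..} x \<partial>lborel) =
        ennreal (C * u powr (p - 1)) * indicator {0..y} u"
    proof eventually_elim
      case (elim u)
      then show ?case
        using int[of u] by (cases "u \<in> {0..y}") auto
    qed
  qed
  also have "\<dots> = ennreal (C * (y powr (p - 1 + 1) / (p - 1 + 1)))"
    using p C y by (intro nn_integral_has_integral_lebesgue' has_integral_mult_right
        has_integral_powr_from_0) auto
  finally show ?thesis by simp
qed

text \<open>The integral for \<open>Gamma (1 - a)\<close> is integrated in the scale from 0 to y.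
  The value is \<open>- Gamma (- a) * y powr a\<close>: subtracting the exponential from 1 restores
  convergence at 0.\<close>

lemma nn_integral_one_minus_exp:
  fixes a y :: real
  assumes a: "0 < a" "a < 1" and y: "y \<ge> 0"
  shows "(\<integral>\<^sup>+x\<in>{0<..}. ennreal (x powr (- a - 1) * (1 - exp (- (y * x)))) \<partial>lborel) =
    ennreal (Gamma (1 - a) * y powr a / a)"
proof (rule nn_integral_antiderivative_param[where h = "\<lambda>x u. x powr (- a) * exp (- (u * x))"])
  fix x u :: real assume "x > 0"
  then have "x powr (- a) = x powr (- a - 1) * x"
    by (simp add: powr_diff)
  then show "((\<lambda>u. x powr (- a - 1) * (1 - exp (- (u * x)))) has_real_derivative
      x powr (- a) * exp (- (u * x))) (at u)"
    by (auto intro!: derivative_eq_intros)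
next
  fix u :: real assume "u > 0"
  then show "(\<integral>\<^sup>+x\<in>{0<..}. ennreal (x powr (- a) * exp (- (u * x))) \<partial>lborel) =
      ennreal (Gamma (1 - a) * u powr (a - 1))"
    using nn_integral_Gamma_scaled[of "1 - a" u] a by simp
qed (use a y in auto)

text \<open>A second integration in the scale. Up to the factor 1/x the integrand now contains the
  exponential minus its first two Taylor terms, and the value is
  \<open>Gamma (- a - 1) * y powr (a + 1)\<close>.\<close>

lemma nn_integral_exp_remainder:
  fixes a y :: real
  assumes a: "0 < a" "a < 1" and y: "y \<ge> 0"
  shows "(\<integral>\<^sup>+x\<in>{0<..}. ennreal (x powr (- a - 1) * (y - (1 - exp (- (y * x))) / x)) \<partial>lborel) =
    ennreal (Gamma (1 - a) / a * y powr (a + 1) / (a + 1))"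
proof (rule nn_integral_antiderivative_param[where h =
    "\<lambda>x u. x powr (- a - 1) * (1 - exp (- (u * x)))"])
  fix x u :: real assume "x > 0"
  then show "((\<lambda>u. x powr (- a - 1) * (u - (1 - exp (- (u * x))) / x)) has_real_derivative
      x powr (- a - 1) * (1 - exp (- (u * x)))) (at u)"
    by (auto intro!: derivative_eq_intros)
next
  fix u :: real assume "u > 0"
  then show "(\<integral>\<^sup>+x\<in>{0<..}. ennreal (x powr (- a - 1) * (1 - exp (- (u * x)))) \<partial>lborel) =
      ennreal (Gamma (1 - a) / a * u powr (a + 1 - 1))"
    using nn_integral_one_minus_exp[OF a, of u] by simp
qed (use a y in auto)

section \<open>Mellin transform of a single partial fraction\<close>

text \<open>Writing 1/(v + b) as the integral of exp(-(v + b) y) over y > 0 and exchanging the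
  integrals leaves two Gamma integrals: the one in v gives \<open>Gamma a * y powr (- a)\<close>,
  and the one in y then gives \<open>Gamma (1 - a) * b powr (a - 1)\<close>.\<close>

lemma nn_integral_powr_over_affine:
  fixes a b :: real
  assumes a: "0 < a" "a < 1" and b: "b > 0"
  shows "(\<integral>\<^sup>+v\<in>{0<..}. ennreal (v powr (a - 1) / (v + b)) \<partial>lborel) =
    ennreal (Gamma a * Gamma (1 - a) * b powr (a - 1))"
proof -
  have "(\<integral>\<^sup>+v\<in>{0<..}. ennreal (v powr (a - 1) / (v + b)) \<partial>lborel) =
     (\<integral>\<^sup>+v. (\<integral>\<^sup>+y. ennreal (v powr (a - 1) * exp (- (v + b) * y)) * indicator {0..} y * indicator
         {0<..} v \<partial>lborel) \<partial>lborel)"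
  proof (rule nn_integral_cong)
    fix v :: real
    show "ennreal (v powr (a - 1) / (v + b)) * indicator {0<..} v =
       (\<integral>\<^sup>+y. ennreal (v powr (a - 1) * exp (- (v + b) * y)) * indicator {0..} y * indicator
           {0<..} v \<partial>lborel)"
    proof (cases "v > 0")
      case True
      define w where "w = v + b"
      have w: "w > 0" using True b by (simp add: w_def)
      have "(\<integral>\<^sup>+y. ennreal (v powr (a - 1) * exp (- w * y)) * indicator {0..} y \<partial>lborel) =
          ennreal (0 - (- (v powr (a - 1)) * exp (- w * 0) / w))"
      proof (rule nn_integral_FTC_atLeast)
        show "((\<lambda>y. - (v powr (a - 1)) * exp (- w * y) / w) \<longlongrightarrow> 0) at_top"
          using w by real_asymp
      qed (use w in \<open>auto intro!: derivative_eq_intros\<close>)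
      then have "(\<integral>\<^sup>+y. ennreal (v powr (a - 1) * exp (- (v + b) * y))
          * indicator {0..} y \<partial>lborel) =
          ennreal (v powr (a - 1) / (v + b))"
        by (simp add: w_def)
      then show ?thesis using True by simp
    qed simp
  qed
  also have "\<dots> = (\<integral>\<^sup>+y.
      (\<integral>\<^sup>+v. ennreal (v powr (a - 1) * exp (- (v + b) * y)) * indicator {0..} y * indicator {0<..}
      v \<partial>lborel) \<partial>lborel)"
    by (rule lborel_pair.Fubini'[symmetric]) measurable
  also have "\<dots> = (\<integral>\<^sup>+y. ennreal (Gamma a)
      * (ennreal (y powr (1 - a - 1) * exp (- (b * y))) * indicator {0<..} y) \<partial>lborel)"
  proof (rule nn_integral_cong_AE)
    \<comment> \<open>At y = 0 the inner integral is infinite while the right-hand side is 0, so the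
      two agree only off this null set.\<close>
    have "AE y in lborel. y \<noteq> (0::real)" by (rule AE_lborel_singleton)
    then show "AE y in lborel.
        (\<integral>\<^sup>+v. ennreal (v powr (a - 1) * exp (- (v + b) * y)) * indicator {0..} y * indicator
        {0<..} v \<partial>lborel) =
        ennreal (Gamma a) * (ennreal (y powr (1 - a - 1) * exp (- (b * y))) * indicator {0<..} y)"
    proof eventually_elim
      case (elim y)
      show ?case
      proof (cases "y > 0")
        case True
        have "(\<integral>\<^sup>+v. ennreal (v powr (a - 1) * exp (- (v + b) * y)) * indicator {0<..} v \<partial>lborel) =
            (\<integral>\<^sup>+v. ennreal (exp (- (b * y)))
                * (ennreal (v powr (a - 1) * exp (- (y * v))) * indicator {0<..} v) \<partial>lborel)"
          by (intro nn_integral_cong)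
              (auto simp: indicator_def algebra_simps simp flip: ennreal_mult' exp_add)
        also have "\<dots> = ennreal (exp (- (b * y))) * ennreal (Gamma a * y powr (- a))"
          using nn_integral_Gamma_scaled[OF a(1) True] by (subst nn_integral_cmult) auto
        finally show ?thesis
          using True a by (simp add: algebra_simps flip: ennreal_mult')
      qed (use elim in auto)
    qed
  qed
  also have "\<dots> = ennreal (Gamma a) * ennreal (Gamma (1 - a) * b powr (a - 1))"
    using nn_integral_Gamma_scaled[of "1 - a" b] a b by (subst nn_integral_cmult) auto
  finally show ?thesis
    using a by (simp add: mult.assoc flip: ennreal_mult')
qed

lemma Gamma_reflection_real:
  fixes a :: real
  shows "Gamma a * Gamma (1 - a) = pi / sin (pi * a)"
proof -
  have "complex_of_real (Gamma a * Gamma (1 - a)) = complex_of_real (pi / sin (pi * a))"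
    using Gamma_reflection_complex[of "of_real a"]
    by (simp flip: Gamma_complex_of_real sin_of_real)
  then show ?thesis by (simp only: of_real_eq_iff)
qed

text \<open>The substitution v = x^2 reduces this to the preceding kind of integral with exponent
  parameter b = (1 - a)/2, chosen so that
  \<open>(x\<^sup>2) powr (b - 1) = x powr (- a - 1)\<close>. The reflection formula at b produces
  the cosine.\<close>

lemma nn_integral_powr_partial_fraction:
  fixes a c :: real
  assumes a: "0 < a" "a < 1" and c: "c > 0"
  shows "(\<integral>\<^sup>+x\<in>{0<..}. ennreal (x powr (- a - 1) * (2 * x / (x\<^sup>2 + c\<^sup>2))) \<partial>lborel) =
    ennreal (pi / cos (pi * a / 2) * c powr (- a - 1))"
proof -
  define b where "b = (1 - a) / 2"
  have b: "0 < b" "b < 1" using a by (auto simp: b_def)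
  have two_b: "2 * (b - 1) = - a - 1" by (simp add: b_def field_simps)
  define f where "f v = v powr (b - 1) / (v + c\<^sup>2)" for v
  have mf: "f \<in> borel_measurable borel" unfolding f_def by measurable
  have f_sq: "f (x\<^sup>2) * (2 * x) = x powr (- a - 1) * (2 * x / (x\<^sup>2 + c\<^sup>2))" if "x \<ge> 0" for x
  proof (cases "x = 0")
    case False
    then have "(x\<^sup>2) powr (b - 1) = x powr (- a - 1)"
      using that unfolding two_b[symmetric] by (simp add: powr_powr flip: powr_numeral)
    then show ?thesis by (simp add: f_def)
  qed auto
  \<comment> \<open>The substitution is made on the compact intervals [0, n] and [0, n^2]; monotone
    convergence on both sides passes to the half-line. The endpoint 0 causes no discrepancy because
    \<open>f 0 = 0\<close>, by the convention that 0 to any power is 0.\<close>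
  have lim1: "(\<lambda>n. \<integral>\<^sup>+v. ennreal (f v) * indicator {(real 0)\<^sup>2..(real n)\<^sup>2} v \<partial>lborel) \<longlonglongrightarrow>
      (\<integral>\<^sup>+v. ennreal (f v) * indicator {0<..} v \<partial>lborel)"
  proof (rule nn_integral_LIMSEQ)
    show "incseq (\<lambda>n v. ennreal (f v) * indicator {(real 0)\<^sup>2..(real n)\<^sup>2} v)"
      by (auto simp: incseq_def le_fun_def indicator_def intro: order_trans power_mono)
    show "(\<lambda>n. ennreal (f v) * indicator {(real 0)\<^sup>2..(real n)\<^sup>2} v) \<longlonglongrightarrow>
        ennreal (f v) * indicator {0<..} v" for v
    proof (cases "v > 0")
      case True
      have "filterlim (\<lambda>n. (real n)\<^sup>2) at_top sequentially" by real_asymp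
      then have "eventually (\<lambda>n. (real n)\<^sup>2 \<ge> v) sequentially"
        by (simp add: filterlim_at_top)
      then have "eventually (\<lambda>n. ennreal (f v) * indicator {0<..} v =
          ennreal (f v) * indicator {(real 0)\<^sup>2..(real n)\<^sup>2} v) sequentially"
        by eventually_elim (use True in auto)
      then show ?thesis by (rule Lim_transform_eventually[OF tendsto_const])
    next
      case False
      then show ?thesis by (cases "v = 0") (auto simp: indicator_def f_def)
    qed
  qed (use mf in measurable)
  have lim2: "(\<lambda>n. \<integral>\<^sup>+x. ennreal (f (x\<^sup>2) * (2 * x)) * indicator {real 0..real n} x \<partial>lborel) \<longlonglongrightarrow>
      (\<integral>\<^sup>+x. ennreal (f (x\<^sup>2) * (2 * x)) * indicator {0<..} x \<partial>lborel)"
  proof (rule nn_integral_LIMSEQ)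
    show "incseq (\<lambda>n x. ennreal (f (x\<^sup>2) * (2 * x)) * indicator {real 0..real n} x)"
      by (auto simp: incseq_def le_fun_def indicator_def)
    show "(\<lambda>n. ennreal (f (x\<^sup>2) * (2 * x)) * indicator {real 0..real n} x) \<longlonglongrightarrow>
        ennreal (f (x\<^sup>2) * (2 * x)) * indicator {0<..} x" for x
    proof (cases "x > 0")
      case True
      have "eventually (\<lambda>n. real n \<ge> x) sequentially"
        using filterlim_real_sequentially by (simp add: filterlim_at_top)
      then have "eventually (\<lambda>n. ennreal (f (x\<^sup>2) * (2 * x)) * indicator {0<..} x =
          ennreal (f (x\<^sup>2) * (2 * x)) * indicator {real 0..real n} x) sequentially"
        by eventually_elim (use True in auto)
      then show ?thesis by (rule Lim_transform_eventually[OF tendsto_const])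
    qed (auto simp: indicator_def f_def)
  qed (use mf in measurable)
  have "(\<integral>\<^sup>+v. ennreal (f v) * indicator {(real 0)\<^sup>2..(real n)\<^sup>2} v \<partial>lborel) =
      (\<integral>\<^sup>+x. ennreal (f (x\<^sup>2) * (2 * x)) * indicator {real 0..real n} x \<partial>lborel)" for n
  proof -
    have "(\<integral>\<^sup>+v. ennreal (f v * indicator {(real 0)\<^sup>2..(real n)\<^sup>2} v) \<partial>lborel) =
      (\<integral>\<^sup>+x. ennreal (f (x\<^sup>2) * (2 * x) * indicator {real 0..real n} x) \<partial>lborel)"
      by (rule nn_integral_substitution)
        (use mf in \<open>auto intro!: derivative_eq_intros continuous_intros simp:
            set_borel_measurable_def\<close>)
    then show ?thesis
      by (simp add: ennreal_indicator[symmetric] ennreal_mult'' del: of_nat_0)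
  qed
  with lim1 lim2 have "(\<integral>\<^sup>+v. ennreal (f v) * indicator {0<..} v \<partial>lborel) =
      (\<integral>\<^sup>+x. ennreal (f (x\<^sup>2) * (2 * x)) * indicator {0<..} x \<partial>lborel)"
    using LIMSEQ_unique by simp
  also have "\<dots> = (\<integral>\<^sup>+x\<in>{0<..}. ennreal (x powr (- a - 1) * (2 * x / (x\<^sup>2 + c\<^sup>2))) \<partial>lborel)"
    using f_sq by (intro nn_integral_cong) (auto simp: indicator_def)
  also have "(\<integral>\<^sup>+v. ennreal (f v) * indicator {0<..} v \<partial>lborel) =
      ennreal (Gamma b * Gamma (1 - b) * (c\<^sup>2) powr (b - 1))"
    unfolding f_def using c by (intro nn_integral_powr_over_affine b) auto
  also have "(c\<^sup>2) powr (b - 1) = c powr (- a - 1)"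
    using c unfolding two_b[symmetric] by (simp add: powr_powr flip: powr_numeral)
  also have "Gamma b * Gamma (1 - b) = pi / cos (pi * a / 2)"
    unfolding Gamma_reflection_real by (simp add: b_def sin_cos_eq field_simps)
  finally show ?thesis by simp
qed

section \<open>The zeta-function and the cotangent\<close>

lemma zeta_holomorphic: "zeta holomorphic_on - {1}"
  using is_zeta_zeta by (simp add: is_zeta_def)

lemma zeta_sums: "Re s > 1 \<Longrightarrow> (\<lambda>n. of_nat (Suc n) powr (- s)) sums zeta s"
  using is_zeta_zeta by (simp add: is_zeta_def)

lemma zeta_has_field_derivative:
  "s \<noteq> 1 \<Longrightarrow> (zeta has_field_derivative deriv zeta s) (at s)"
  using holomorphic_derivI[OF zeta_holomorphic] by auto

lemma cnj_of_nat_powr: "cnj (of_nat (Suc n) powr s) = of_nat (Suc n) powr (cnj s)"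
  by (simp add: powr_def exp_cnj Ln_of_nat del: of_nat_Suc)

text \<open>Conjugating the argument and the value of zeta gives a function with the same Dirichlet
  series, pole and convention at 1, so the uniqueness of the continuation applies.\<close>

lemma zeta_cnj: "zeta (cnj s) = cnj (zeta s)"
proof -
  have "is_zeta (cnj \<circ> zeta \<circ> cnj)"
    unfolding is_zeta_def
  proof (intro conjI allI impI)
    have "cnj ` (- {1}) = - {1}"
      unfolding image_cnj_conv_vimage_cnj by auto
    then show "cnj \<circ> zeta \<circ> cnj holomorphic_on - {1}"
      using zeta_holomorphic by (intro holomorphic_on_compose_cnj_cnj) auto
    show "(cnj \<circ> zeta \<circ> cnj) 1 = 0"
      using is_zeta_zeta by (simp add: is_zeta_def)
    fix s :: complex assume "Re s > 1"
    then have "(\<lambda>n. of_nat (Suc n) powr (- cnj s)) sums zeta (cnj s)"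
      by (intro zeta_sums) auto
    then have "(\<lambda>n. cnj (of_nat (Suc n) powr (- cnj s))) sums cnj (zeta (cnj s))"
      by (simp only: sums_cnj)
    then show "(\<lambda>n. of_nat (Suc n) powr (- s)) sums (cnj \<circ> zeta \<circ> cnj) s"
      by (simp add: cnj_of_nat_powr del: of_nat_Suc)
  qed
  then have "cnj \<circ> zeta \<circ> cnj = zeta"
    using is_zeta_unique is_zeta_zeta by blast
  then have "(cnj \<circ> zeta \<circ> cnj) (cnj s) = zeta (cnj s)" by simp
  then show ?thesis by simp
qed

lemma deriv_zeta_cnj:
  assumes "s \<noteq> 1"
  shows "deriv zeta (cnj s) = cnj (deriv zeta s)"
proof -
  have "(cnj \<circ> zeta \<circ> cnj has_field_derivative cnj (deriv zeta s)) (at (cnj s))"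
    using zeta_has_field_derivative[OF assms] by (intro has_field_derivative_cnj_cnj) simp
  moreover have "cnj \<circ> zeta \<circ> cnj = zeta"
    by (simp add: fun_eq_iff zeta_cnj)
  ultimately show ?thesis by (simp add: DERIV_imp_deriv)
qed

section \<open>Euler-Maclaurin summation in the half-plane Re s > -1\<close>

text \<open>The errors of the trapezoidal rule for \<open>x powr (- s)\<close> on the intervals
  [n + 1, n + 2], multiplied by 1 - s, form a series with holomorphic sum G on Re s > -1. Their
  partial sums telescope to the stated expression, G is expressed through zeta for Re s > 1, and the
  identity theorem carries this relation to the left.\<close>

lemma zeta_trapezoid_LIMSEQ:
  assumes s: "Re s > - 1" "s \<noteq> 1"
  shows "(\<lambda>N. (\<Sum>k\<le>N. of_nat (Suc k) powr (- s)) - of_nat (Suc N) powr (- s) / 2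
           - of_nat (Suc N) powr (1 - s) / (1 - s)) \<longlonglongrightarrow> zeta s"
proof -
  obtain g1 where g1: "g1 holomorphic_on {s. Re s > 0}"
    and g1s: "\<And>s. Re s > 0 \<Longrightarrow> (\<lambda>n. taylor_rem 1 n s) sums g1 s"
    using taylor_rem_series[of 1] by auto
  obtain g2 where g2: "g2 holomorphic_on {s. Re s > - 1}"
    and g2s: "\<And>s. Re s > - 1 \<Longrightarrow> (\<lambda>n. taylor_rem 2 n s) sums g2 s"
    using taylor_rem_series[of 2] by auto
  \<comment> \<open>The two Taylor remainders are combined so that their terms in
    \<open>of_nat (Suc n) powr (- s - 1)\<close> cancel; what is left is 1 - s times the trapezoid
    error.\<close>
  define G where "G s = (1 - s) / 2 * g1 (s + 1) - g2 s" for s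
  have "(g1 \<circ> (\<lambda>s. s + 1)) holomorphic_on {s. Re s > - 1}"
    by (rule holomorphic_on_compose_gen[OF _ g1]) (auto intro!: holomorphic_intros)
  then have G_hol: "G holomorphic_on {s. Re s > - 1}"
    unfolding G_def by (intro holomorphic_intros g2) (auto simp: o_def)
  have G_sums: "(\<lambda>n. (1 - s) / 2 * (of_nat (Suc n) powr (- s) + of_nat (Suc (Suc n)) powr (- s))
      - (of_nat (Suc (Suc n)) powr (1 - s) - of_nat (Suc n) powr (1 - s))) sums G s"
    if "Re s > - 1" for s
  proof -
    have sums: "(\<lambda>n. (1 - s) / 2 * taylor_rem 1 n (s + 1) - taylor_rem 2 n s) sums G s"
      unfolding G_def using that by (intro sums_diff sums_mult g1s g2s) auto
    have r1: "taylor_rem 1 n (s + 1) = of_nat (Suc (Suc n)) powr (- s) - of_nat (Suc n) powr (- s)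
        + s * of_nat (Suc n) powr (- s - 1)" for n
    proof -
      have "{..1::nat} = {0, 1}" "{..<1::nat} = {0}" by auto
      then show ?thesis
        by (simp add: taylor_rem_def taylor_coeff_def diff_diff_eq[symmetric] del: of_nat_Suc
            One_nat_def)
    qed
    have r2: "taylor_rem 2 n s = of_nat (Suc (Suc n)) powr (1 - s) - of_nat (Suc n) powr (1 - s)
        - (1 - s) * of_nat (Suc n) powr (- s) + (1 - s) * s / 2 * of_nat (Suc n) powr
            (- s - 1)" for n
    proof -
      have "{..2::nat} = {0, 1, 2}" "{..<2::nat} = {0, 1}" by auto
      moreover have "1 - s - 2 = - s - 1" by simp
      ultimately show ?thesis
        by (simp add: taylor_rem_def taylor_coeff_def fact_2 del: of_nat_Suc One_nat_def)
          (simp add: algebra_simps minus_diff_commute del: of_nat_Suc One_nat_def)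
    qed
    have "(1 - s) / 2 * taylor_rem 1 n (s + 1) - taylor_rem 2 n s =
        (1 - s) / 2 * (of_nat (Suc n) powr (- s) + of_nat (Suc (Suc n)) powr (- s))
        - (of_nat (Suc (Suc n)) powr (1 - s) - of_nat (Suc n) powr (1 - s))" for n
      unfolding r1 r2 by (simp add: field_simps del: of_nat_Suc)
    with sums show ?thesis by (simp only:)
  qed
  \<comment> \<open>The power differences telescope and every interior node is counted twice with
    weight 1/2. The constant (1 + s)/2 makes the right-hand side vanish at N = 0.\<close>
  have partial: "(\<Sum>n<N. (1 - s) / 2 * (of_nat (Suc n) powr (- s) + of_nat (Suc (Suc n)) powr (- s))
      - (of_nat (Suc (Suc n)) powr (1 - s) - of_nat (Suc n) powr (1 - s))) =
      (1 - s) * ((\<Sum>k\<le>N. of_nat (Suc k) powr (- s)) - of_nat (Suc N) powr (- s) / 2)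
      - of_nat (Suc N) powr (1 - s) + (1 + s) / 2" for N :: nat and s :: complex
  proof (induction N)
    case (Suc N)
    show ?case
      unfolding sum.lessThan_Suc Suc.IH sum.atMost_Suc by (simp add: field_simps del: of_nat_Suc)
  qed (simp add: field_simps)
  have G_lim: "(\<lambda>N. (1 - s) * ((\<Sum>k\<le>N. of_nat (Suc k) powr (- s)) - of_nat (Suc N) powr (- s) / 2)
      - of_nat (Suc N) powr (1 - s) + (1 + s) / 2) \<longlonglongrightarrow> G s" if "Re s > - 1" for s
    using G_sums[OF that] unfolding sums_def partial .
  have G_zeta1: "G s = (1 - s) * zeta s + (1 + s) / 2" if s: "Re s > 1" for s
  proof (rule LIMSEQ_unique[OF G_lim])
    have "(\<lambda>N. \<Sum>k\<le>N. of_nat (Suc k) powr (- s)) \<longlonglongrightarrow> zeta s"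
      using zeta_sums[OF s] by (simp only: sums_def_le)
    moreover have "(\<lambda>N. (of_nat (Suc N) :: complex) powr (- s)) \<longlonglongrightarrow> 0"
      using zeta_sums[OF s] by (intro summable_LIMSEQ_zero) (rule sums_summable)
    ultimately have "(\<lambda>N. (1 - s)
        * ((\<Sum>k\<le>N. of_nat (Suc k) powr (- s)) - of_nat (Suc N) powr (- s) / 2)
        - of_nat (Suc N) powr (1 - s) + (1 + s) / 2) \<longlonglongrightarrow> (1 - s) * (zeta s - 0 / 2) - 0 + (1 + s) / 2"
      by (intro tendsto_intros nat_powr_tendsto_0 s) auto
    then show "(\<lambda>N. (1 - s) * ((\<Sum>k\<le>N. of_nat (Suc k) powr (- s)) - of_nat (Suc N) powr (- s) / 2)
        - of_nat (Suc N) powr (1 - s) + (1 + s) / 2) \<longlonglongrightarrow> (1 - s) * zeta s + (1 + s) / 2"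
      by simp
  qed (use s in auto)
  have G_zeta: "G s = (1 - s) * zeta s + (1 + s) / 2"
  proof (rule analytic_continuation_open[where s = "{s. Re s > 1}" and s' = "{s. Re s > - 1} - {1}"
        and f = G and g = "\<lambda>s. (1 - s) * zeta s + (1 + s) / 2"])
    show "connected ({s. Re s > - 1} - {1 :: complex})"
      by (intro connected_open_delete convex_connected convex_halfspace_Re_gt
          open_halfspace_Re_gt) auto
    show "open ({s. Re s > - 1} - {1})"
      by (intro open_delete open_halfspace_Re_gt)
    show "{s. Re s > 1} \<noteq> {}" by (auto intro: exI[of _ 2])
    show "G holomorphic_on {s. Re s > - 1} - {1}"
      by (rule holomorphic_on_subset[OF G_hol]) auto
    show "(\<lambda>s. (1 - s) * zeta s + (1 + s) / 2) holomorphic_on {s. Re s > - 1} - {1}"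
      by (intro holomorphic_intros holomorphic_on_subset[OF zeta_holomorphic]) auto
  qed (use G_zeta1 s in \<open>auto intro: open_halfspace_Re_gt\<close>)
  have "(\<lambda>N. (((1 - s) * ((\<Sum>k\<le>N. of_nat (Suc k) powr (- s)) - of_nat (Suc N) powr (- s) / 2)
      - of_nat (Suc N) powr (1 - s) + (1 + s) / 2) - (1 + s) / 2) / (1 - s))
      \<longlonglongrightarrow> (G s - (1 + s) / 2) / (1 - s)"
    using s by (intro tendsto_divide tendsto_diff[where b = "(1 + s) / 2"] tendsto_const G_lim) auto
  then show ?thesis using s by (simp add: G_zeta diff_divide_distrib del: of_nat_Suc)
qed

section \<open>Partial fractions of the cotangent\<close>

text \<open>The logarithmic derivative of the reflection formula
  \<open>rGamma z * rGamma (1 - z) = sin (pi * z) / pi\<close> is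
  \<open>Digamma (1 - z) - Digamma z = pi * cot (pi * z)\<close>. Inserting the limit formula for
  \<open>Digamma\<close>, in which the logarithms cancel, gives the series.\<close>

lemma pi_cot_sums:
  fixes z :: complex
  assumes z: "z \<notin> \<int>"
  shows "(\<lambda>n. 1 / (z + of_nat (Suc n)) + 1 / (z - of_nat (Suc n))) sums
      (of_real pi * cot (of_real pi * z) - 1 / z)"
proof -
  have z1: "1 - z \<notin> \<int>"
    using z by (metis Ints_1 Ints_diff diff_diff_eq2 add_diff_cancel_left')
  have nz: "z \<noteq> 0" "1 - z \<noteq> 0" using z z1 by auto
  have np: "z \<notin> \<int>\<^sub>\<le>\<^sub>0" "1 - z \<notin> \<int>\<^sub>\<le>\<^sub>0"
    using z z1 nonpos_Ints_Int by blast+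
  have "((\<lambda>z. rGamma z * rGamma (1 - z)) has_field_derivative
      rGamma z * rGamma (1 - z) * (Digamma (1 - z) - Digamma z)) (at z)"
    using np by (auto intro!: derivative_eq_intros simp: algebra_simps)
  moreover have "((\<lambda>z. rGamma z * rGamma (1 - z)) has_field_derivative cos (of_real pi * z)) (at z)"
    unfolding rGamma_reflection_complex by (auto intro!: derivative_eq_intros)
  ultimately have "rGamma z * rGamma (1 - z) * (Digamma (1 - z) - Digamma z) = cos (of_real pi * z)"
    by (rule DERIV_unique)
  moreover have "rGamma z * rGamma (1 - z) \<noteq> 0"
    using np by (simp add: rGamma_eq_zero_iff)
  ultimately have eq: "Digamma (1 - z) - Digamma z = of_real pi * cot (of_real pi * z)"
    unfolding rGamma_reflection_complex cot_def by (auto simp: field_simps)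
  \<comment> \<open>The terms \<open>- 1 / z\<close> and \<open>1 / (z + of_nat m)\<close> shift the
    sum of the \<open>inverse (z + of_nat n)\<close> from the indices 0..m-1 to 1..m, matching the
    indices of the other sum.\<close>
  have "(\<lambda>m. (of_real (ln (real m)) - (\<Sum>n<m. inverse (1 - z + of_nat n))) -
      (of_real (ln (real m)) - (\<Sum>n<m. inverse (z + of_nat n))) - 1 / z + 1 / (z + of_nat m))
     \<longlonglongrightarrow> Digamma (1 - z) - Digamma z - 1 / z + 0"
    using nz by (intro tendsto_intros Digamma_LIMSEQ tendsto_divide_0[OF tendsto_const]
        tendsto_add_filterlim_at_infinity[OF tendsto_const] tendsto_of_nat)
  moreover have "(of_real (ln (real m)) - (\<Sum>n<m. inverse (1 - z + of_nat n))) -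
      (of_real (ln (real m)) - (\<Sum>n<m. inverse (z + of_nat n))) - 1 / z + 1 / (z + of_nat m) =
      (\<Sum>n<m. 1 / (z + of_nat (Suc n)) + 1 / (z - of_nat (Suc n)))" for m
  proof (induction m)
    case (Suc m)
    have "inverse (1 - z + of_nat m) = - (1 / (z - of_nat (Suc m)))"
      by (simp add: inverse_eq_divide minus_divide_right algebra_simps)
    with Suc show ?case by (simp add: inverse_eq_divide algebra_simps)
  qed simp
  ultimately show ?thesis by (simp add: sums_def eq)
qed

section \<open>The functional equation\<close>

text \<open>This is the cotangent expansion at z = i x/(2 pi), multiplied by i/(2 pi). There z^2 -
  n^2 is a negative real multiple of x^2 + (2 pi n)^2, and cot(pi z) is -i coth(x/2) = -i (1 +
  2/(exp x - 1)).\<close>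

lemma bose_partial_fractions_sums:
  fixes x :: real
  assumes x: "x > 0"
  shows "(\<lambda>n. 2 * x / (x\<^sup>2 + (2 * pi * real (Suc n))\<^sup>2)) sums (1 / (exp x - 1) - 1 / x + 1 / 2)"
proof -
  define z where "z = \<i> * of_real (x / (2 * pi))"
  have "z \<notin> \<int>"
  proof
    assume "z \<in> \<int>"
    then have "Im z = 0" by (auto elim: Ints_cases)
    then show False using x by (simp add: z_def)
  qed
  then have "(\<lambda>n. (1 / (z + of_nat (Suc n)) + 1 / (z - of_nat (Suc n))) * (\<i> / (2 * pi))) sums
      ((of_real pi * cot (of_real pi * z) - 1 / z) * (\<i> / (2 * pi)))"
    by (intro sums_mult2 pi_cot_sums)
  moreover have "(1 / (z + of_nat (Suc n)) + 1 / (z - of_nat (Suc n))) * (\<i> / (2 * pi)) =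
      of_real (2 * x / (x\<^sup>2 + (2 * pi * real (Suc n))\<^sup>2))" for n
  proof -
    define m where "m = real (Suc n)"
    have m: "m > 0" by (simp add: m_def)
    have nz: "z + of_real m \<noteq> 0" "z - of_real m \<noteq> 0"
      using m by (auto simp: z_def complex_eq_iff)
    have "(z + of_real m) * (z - of_real m) = - of_real ((x\<^sup>2 + (2 * pi * m)\<^sup>2) / (2 * pi)\<^sup>2)"
      by (simp add: z_def field_simps power2_eq_square)
    moreover have "1 / (z + of_real m) + 1 / (z - of_real m) =
        2 * z / ((z + of_real m) * (z - of_real m))"
      using nz by (simp add: field_simps)
    ultimately have "(1 / (z + of_real m) + 1 / (z - of_real m)) * (\<i> / (2 * pi)) =
        2 * z / (- of_real ((x\<^sup>2 + (2 * pi * m)\<^sup>2) / (2 * pi)\<^sup>2)) * (\<i> / (2 * pi))"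
      by simp
    also have "\<dots> = of_real (2 * x / (x\<^sup>2 + (2 * pi * m)\<^sup>2))"
    proof -
      have "x\<^sup>2 + (2 * pi * m)\<^sup>2 \<noteq> 0" using x by (simp add: sum_power2_eq_zero_iff)
      then have "complex_of_real (x\<^sup>2 + (2 * pi * m)\<^sup>2) \<noteq> 0"
          by (simp only: of_real_eq_0_iff not_False_eq_True)
      then show ?thesis
        by (simp add: z_def field_simps power2_eq_square del: of_real_add)
    qed
    finally show ?thesis by (simp add: m_def)
  qed
  moreover have "(of_real pi * cot (of_real pi * z) - 1 / z) * (\<i> / (2 * pi)) =
      of_real (1 / (exp x - 1) - 1 / x + 1 / 2)"
  proof -
    \<comment> \<open>In terms of E the hyperbolic cotangent of x/2 is rational, and
      \<open>exp x\<close> is its square.\<close>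
    define E where "E = exp (x / 2)"
    have E: "E > 1" "exp x = E\<^sup>2" using x by (auto simp: E_def power2_eq_square simp flip: exp_add)
    have E1: "E\<^sup>2 - 1 \<noteq> 0" using E(1) by (simp add: power2_eq_1_iff)
    have piz: "of_real pi * z = \<i> * of_real (x / 2)" by (simp add: z_def)
    have exps: "exp (\<i> * (of_real pi * z)) = of_real (1 / E)"
        "exp (- (\<i> * (of_real pi * z))) = of_real E"
    proof -
      have "\<i> * (of_real pi * z) = of_real (- (x / 2))" by (simp add: piz)
      then show "exp (\<i> * (of_real pi * z)) = of_real (1 / E)"
          "exp (- (\<i> * (of_real pi * z))) = of_real E"
        by (simp_all only: of_real_minus[symmetric] exp_of_real E_def minus_minus
            exp_minus[of "x / 2"] inverse_eq_divide)
    qed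
    have "cot (of_real pi * z) =
        (of_real (1 / E) + of_real E) / 2 / ((of_real (1 / E) - of_real E) / (2 * \<i>))"
      by (simp only: cot_def cos_exp_eq sin_exp_eq exps)
    also have "\<dots> = \<i> * of_real ((1 / E + E) / (1 / E - E))"
    proof -
      have "u / 2 / (v / (2 * \<i>)) = \<i> * (u / v)" for u v :: complex
        by (cases "v = 0") (simp_all add: field_simps)
      then show ?thesis by (simp only: of_real_add of_real_diff of_real_divide)
    qed
    also have "(1 / E + E) / (1 / E - E) = - (E\<^sup>2 + 1) / (E\<^sup>2 - 1)"
      using E(1) E1 by (simp add: divide_simps power2_eq_square) (simp add: algebra_simps)
    also have "\<i> * of_real (- (E\<^sup>2 + 1) / (E\<^sup>2 - 1)) = - \<i> * of_real (1 + 2 / (exp x - 1))"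
      using E E1 by (simp add: field_simps) 
    finally have cot: "cot (of_real pi * z) = - \<i> * of_real (1 + 2 / (exp x - 1))" .
    have "1 / z = - \<i> * of_real (2 * pi / x)"
      using x by (simp add: z_def field_simps)
    then show ?thesis unfolding cot by (simp add: field_simps)
  qed
  ultimately show ?thesis by (simp only: sums_of_real_iff)
qed

lemma zeta_of_real: "zeta (of_real x) = of_real (Re (zeta (of_real x)))"
  using zeta_cnj[of "of_real x"] by (simp add: complex_eq_iff)

lemma cos_pi_half_pos:
  fixes a :: real
  assumes "0 < a" "a < 1"
  shows "cos (pi * a / 2) > 0"
  using assms by (intro cos_gt_zero_pi) (auto simp: field_simps intro: order_less_trans[of _ 0])

text \<open>The partial fractions are nonnegative, so they may be integrated termwise; the n-th one
  contributes a multiple of \<open>real (Suc n) powr (- a - 1)\<close>. The sign of the zeta value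
  is recorded because \<open>ennreal\<close> sends negative reals to 0, so that an equation between
  \<open>ennreal\<close> values yields a real one only for nonnegative reals.\<close>

lemma nn_integral_bose_zeta_gt_1:
  fixes a :: real
  assumes a: "0 < a" "a < 1"
  shows "(\<integral>\<^sup>+x\<in>{0<..}. ennreal (x powr (- a - 1) * (1 / (exp x - 1) - 1 / x + 1 / 2)) \<partial>lborel) =
    ennreal (pi / cos (pi * a / 2) * (2 * pi) powr (- a - 1) * Re (zeta (of_real (1 + a))))"
    and "Re (zeta (of_real (1 + a))) \<ge> 0"
proof -
  have "(\<lambda>n. of_nat (Suc n) powr (- of_real (1 + a))) sums zeta (of_real (1 + a))"
    using a by (intro zeta_sums) auto
  also have "- complex_of_real (1 + a) = of_real (- a - 1)"
    by simp
  also have "(\<lambda>n. (of_nat (Suc n) :: complex) powr (of_real (- a - 1))) =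
      (\<lambda>n. of_real (real (Suc n) powr (- a - 1)))"
    by (simp add: powr_of_real[symmetric] del: of_nat_Suc of_real_diff of_real_minus)
  finally have sums: "(\<lambda>n. real (Suc n) powr (- a - 1)) sums Re (zeta (of_real (1 + a)))"
    by (subst (asm) zeta_of_real) (simp only: sums_of_real_iff)
  show "Re (zeta (of_real (1 + a))) \<ge> 0"
    by (rule sums_le[OF _ sums_zero sums]) auto
  have cos: "cos (pi * a / 2) > 0"
    by (rule cos_pi_half_pos[OF a])
  have "(\<integral>\<^sup>+x\<in>{0<..}. ennreal (x powr (- a - 1) * (1 / (exp x - 1) - 1 / x + 1 / 2)) \<partial>lborel) =
      (\<integral>\<^sup>+x. (\<Sum>n. ennreal (x powr (- a - 1) * (2 * x / (x\<^sup>2 + (2 * pi * real (Suc n))\<^sup>2)))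
          * indicator {0<..} x) \<partial>lborel)"
  proof (rule nn_integral_cong)
    fix x :: real
    show "ennreal (x powr (- a - 1) * (1 / (exp x - 1) - 1 / x + 1 / 2)) * indicator {0<..} x =
       (\<Sum>n. ennreal (x powr (- a - 1) * (2 * x / (x\<^sup>2 + (2 * pi * real (Suc n))\<^sup>2))) * indicator
           {0<..} x)"
    proof (cases "x > 0")
      case True
      have "(\<Sum>n. ennreal (x powr (- a - 1) * (2 * x / (x\<^sup>2 + (2 * pi * real (Suc n))\<^sup>2)))) =
          ennreal (x powr (- a - 1) * (1 / (exp x - 1) - 1 / x + 1 / 2))"
        using True by (intro suminf_ennreal_eq sums_mult bose_partial_fractions_sums) auto
      then show ?thesis
        using True by (simp only: indicator_simps greaterThan_iff mult_1_right)
    qed simp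
  qed
  also have "\<dots> = (\<Sum>n. \<integral>\<^sup>+x. ennreal (x powr
      (- a - 1) * (2 * x / (x\<^sup>2 + (2 * pi * real (Suc n))\<^sup>2))) * indicator {0<..} x \<partial>lborel)"
    by (rule nn_integral_suminf) measurable
  also have "\<dots> = (\<Sum>n. ennreal (pi / cos (pi * a / 2) * (2 * pi * real (Suc n)) powr (- a - 1)))"
    using a by (subst nn_integral_powr_partial_fraction) auto
  also have "(\<lambda>n. pi / cos (pi * a / 2) * (2 * pi * real (Suc n)) powr (- a - 1)) =
      (\<lambda>n. pi / cos (pi * a / 2) * (2 * pi) powr (- a - 1) * real (Suc n) powr (- a - 1))"
    by (simp add: powr_mult mult.assoc del: of_nat_Suc)
  also have "(\<Sum>n. ennreal (pi / cos (pi * a / 2) * (2 * pi) powr (- a - 1) * real (Suc n) powr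
      (- a - 1))) =
      ennreal (pi / cos (pi * a / 2) * (2 * pi) powr (- a - 1) * Re (zeta (of_real (1 + a))))"
    using cos by (intro suminf_ennreal_eq sums_mult sums) auto
  finally show "(\<integral>\<^sup>+x\<in>{0<..}. ennreal (x powr
      (- a - 1) * (1 / (exp x - 1) - 1 / x + 1 / 2)) \<partial>lborel) =
    ennreal (pi / cos (pi * a / 2) * (2 * pi) powr (- a - 1) * Re (zeta (of_real (1 + a))))" .
qed

section \<open>The same transform by exponentials, giving zeta (- a)\<close>

text \<open>The geometric sum of the \<open>exp (- (real (Suc k) * x))\<close> equals (1 - exp(-N
  x))/(exp x - 1), so the Bose terms cancel. The grouping leaves only nonnegative pieces, and all
  but the first have a known Mellin integral.\<close>

lemma bose_truncated:
  fixes x :: real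
  assumes "x > 0"
  shows "(1 / (exp x - 1) - 1 / x + 1 / 2) * (1 - exp (- (real N * x)))
      + (\<Sum>k<N. 1 - exp (- (real (Suc k) * x))) =
    (real N - (1 - exp (- (real N * x))) / x) + (1 - exp (- (real N * x))) / 2"
proof -
  have "exp x - 1 > 0" using assms by simp
  then have "(\<Sum>k<N. exp (- (real (Suc k) * x))) = (1 - exp (- (real N * x))) / (exp x - 1)"
  proof (induction N)
    case (Suc N)
    have "exp (- (real N * x)) = exp (- (real (Suc N) * x)) * exp x"
      by (simp add: algebra_simps flip: exp_add)
    with Suc show ?case by (simp add: field_simps del: of_nat_Suc)
  qed simp
  then show ?thesis by (simp add: sum_subtractf algebra_simps diff_divide_distrib del: of_nat_Suc)
qed

text \<open>The factor 1 - exp(-N x) increases to 1, so the integral is the limit of the truncated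
  integrals \<open>P N\<close>. The truncated identity evaluates \<open>P N\<close> as c times
  \<open>R N\<close>, and \<open>R N\<close> is minus the Euler-Maclaurin expression at s = -a,
  which tends to minus zeta (- a).\<close>

lemma nn_integral_bose_zeta_neg:
  fixes a :: real
  assumes a: "0 < a" "a < 1"
  shows "(\<integral>\<^sup>+x\<in>{0<..}. ennreal (x powr (- a - 1) * (1 / (exp x - 1) - 1 / x + 1 / 2)) \<partial>lborel) =
    ennreal (- Gamma (1 - a) / a * Re (zeta (of_real (- a))))"
    and "Re (zeta (of_real (- a))) \<le> 0"
proof -
  define f :: "real \<Rightarrow> real" where "f x = 1 / (exp x - 1) - 1 / x + 1 / 2" for x
  have f_nonneg: "f x \<ge> 0" if "x > 0" for x
    unfolding f_def using that by (intro sums_le[OF _ sums_zero bose_partial_fractions_sums]) auto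
  have mf [measurable]: "f \<in> borel_measurable borel" unfolding f_def by measurable
  define w where "w x = x powr (- a - 1)" for x
  have [simp]: "w x \<ge> 0" for x by (simp add: w_def)
  have mw [measurable]: "w \<in> borel_measurable borel" unfolding w_def by measurable
  define c where "c = Gamma (1 - a) / a"
  have c: "c > 0" using a by (simp add: c_def)
  define P where "P N = (\<integral>\<^sup>+x\<in>{0<..}. ennreal (w x * (f x * (1 - exp (- (real N * x))))) \<partial>lborel)"
      for N :: nat
  define R where "R N = real N powr (a + 1) / (a + 1) + real N powr a / 2
      - (\<Sum>k<N. real (Suc k) powr a)" for N :: nat
  have int1: "(\<integral>\<^sup>+x\<in>{0<..}. ennreal (w x * (1 - exp (- (y * x)))) \<partial>lborel) =
      ennreal (c * y powr a)" if "y \<ge> 0" for y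
    using nn_integral_one_minus_exp[OF a that] by (simp add: w_def c_def)
  have int2: "(\<integral>\<^sup>+x\<in>{0<..}. ennreal (w x * (y - (1 - exp (- (y * x))) / x)) \<partial>lborel) =
      ennreal (c * (y powr (a + 1) / (a + 1)))" if "y \<ge> 0" for y
    using nn_integral_exp_remainder[OF a that] by (simp add: w_def c_def)
  have P: "P N = ennreal (c * R N) \<and> R N \<ge> 0" for N
  proof -
    define S where "S = (\<Sum>k<N. real (Suc k) powr a)"
    have S: "S \<ge> 0" unfolding S_def by (intro sum_nonneg) auto
    define T where "T = real N powr (a + 1) / (a + 1) + real N powr a / 2"
    \<comment> \<open>Subtraction in \<open>ennreal\<close> is truncated, so the finite sum stays on
      the left with \<open>P N\<close> until both sides are evaluated.\<close>
    have "P N + ennreal (c * S) =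
        P N + (\<Sum>k<N. \<integral>\<^sup>+x\<in>{0<..}. ennreal (w x * (1 - exp (- (real (Suc k) * x)))) \<partial>lborel)"
      using c by (subst int1) (auto simp: S_def sum_distrib_left intro!: sum_ennreal[symmetric])
    also have "\<dots> = (\<integral>\<^sup>+x. ennreal (w x * (f x * (1 - exp (- (real N * x))))) * indicator {0<..} x
        + (\<Sum>k<N. ennreal (w x * (1 - exp (- (real (Suc k) * x)))) * indicator {0<..} x) \<partial>lborel)"
      unfolding P_def by (subst nn_integral_sum[symmetric], measurable, subst
          nn_integral_add[symmetric], measurable)
    also have "\<dots> = (\<integral>\<^sup>+x. ennreal (w x * (real N - (1 - exp (- (real N * x))) / x))
        * indicator {0<..} x
        + ennreal (1 / 2) * (ennreal (w x * (1 - exp (- (real N * x)))) * indicator {0<..} x)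
            \<partial>lborel)"
    proof (rule nn_integral_cong)
      fix x :: real
      show "ennreal (w x * (f x * (1 - exp (- (real N * x))))) * indicator {0<..} x
        + (\<Sum>k<N. ennreal (w x * (1 - exp (- (real (Suc k) * x)))) * indicator {0<..} x) =
        ennreal (w x * (real N - (1 - exp (- (real N * x))) / x)) * indicator {0<..} x
        + ennreal (1 / 2) * (ennreal (w x * (1 - exp (- (real N * x)))) * indicator {0<..} x)"
      proof (cases "x > 0")
        case True
        have q: "1 - exp (- (y * x)) \<ge> 0" if "y \<ge> 0" for y using that True by simp
        have r: "real N - (1 - exp (- (real N * x))) / x \<ge> 0"
          using exp_ge_add_one_self[of "- (real N * x)"] True by (simp add: field_simps)
        have "w x * (f x * (1 - exp (- (real N * x))))
            + (\<Sum>k<N. w x * (1 - exp (- (real (Suc k) * x)))) =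
            w x * (real N - (1 - exp (- (real N * x))) / x) + 1 / 2
                * (w x * (1 - exp (- (real N * x))))"
          using arg_cong[OF bose_truncated[OF True, of N], of "\<lambda>u. w x * u"]
          by (simp add: f_def ring_distribs sum_distrib_left del: of_nat_Suc)
        moreover have "(\<Sum>k<N. ennreal (w x * (1 - exp (- (real (Suc k) * x))))) =
            ennreal (\<Sum>k<N. w x * (1 - exp (- (real (Suc k) * x))))"
          by (intro sum_ennreal mult_nonneg_nonneg q) auto
        moreover have "ennreal (w x * (f x * (1 - exp (- (real N * x))))
            + (\<Sum>k<N. w x * (1 - exp (- (real (Suc k) * x))))) =
            ennreal (w x * (f x * (1 - exp (- (real N * x))))) + ennreal
                (\<Sum>k<N. w x * (1 - exp (- (real (Suc k) * x))))"
          by (intro ennreal_plus mult_nonneg_nonneg sum_nonneg q f_nonneg True) auto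
        moreover have "ennreal (w x * (real N - (1 - exp (- (real N * x))) / x)
            + 1 / 2 * (w x * (1 - exp (- (real N * x))))) =
            ennreal (w x * (real N - (1 - exp (- (real N * x))) / x)) + ennreal
                (1 / 2 * (w x * (1 - exp (- (real N * x)))))"
          by (intro ennreal_plus mult_nonneg_nonneg q r) auto
        moreover have "ennreal (1 / 2 * (w x * (1 - exp (- (real N * x))))) =
            ennreal (1 / 2) * ennreal (w x * (1 - exp (- (real N * x))))"
          by (rule ennreal_mult') simp
        ultimately show ?thesis using True
            by (simp only: indicator_simps greaterThan_iff mult_1_right)
      qed simp
    qed
    also have "\<dots> = ennreal (c * (real N powr (a + 1) / (a + 1)))
        + ennreal (1 / 2) * ennreal (c * real N powr a)"
      by (subst nn_integral_add, measurable, subst nn_integral_cmult, measurable, subst int1,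
          simp, subst int2, simp, simp)
    also have "\<dots> = ennreal (c * T)"
    proof -
      have "c * T = c * (real N powr (a + 1) / (a + 1)) + 1 / 2 * (c * real N powr a)"
        by (simp add: T_def ring_distribs)
      moreover have "ennreal (c * (real N powr (a + 1) / (a + 1)) + 1 / 2 * (c * real N powr a)) =
          ennreal (c * (real N powr (a + 1) / (a + 1))) + ennreal (1 / 2 * (c * real N powr a))"
        using a c by (intro ennreal_plus) auto
      moreover have "ennreal (1 / 2 * (c * real N powr a)) =
          ennreal (1 / 2) * ennreal (c * real N powr a)"
        by (rule ennreal_mult') simp
      ultimately show ?thesis by (simp only:)
    qed
    finally have PT: "P N + ennreal (c * S) = ennreal (c * T)" .
    \<comment> \<open>Nonnegativity of the integral \<open>P N\<close> yields S <= T, which is the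
      claim \<open>R N \<ge> 0\<close>; the finite \<open>c * S\<close> can then be
      cancelled.\<close>
    have "ennreal (c * S) \<le> P N + ennreal (c * S)" by (rule add_increasing) auto
    then have "ennreal (c * S) \<le> ennreal (c * T)" unfolding PT .
    moreover have "T \<ge> 0" using a by (simp add: T_def)
    ultimately have ST: "S \<le> T" using c by (simp add: ennreal_le_iff)
    have "P N = P N + ennreal (c * S) - ennreal (c * S)"
      by (rule ennreal_add_diff_cancel_right[symmetric]) simp
    also have "\<dots> = ennreal (c * T) - ennreal (c * S)" unfolding PT ..
    also have "\<dots> = ennreal (c * T - c * S)" using c S by (intro ennreal_minus) auto
    also have "c * T - c * S = c * R N"
      by (simp only: R_def S_def T_def right_diff_distrib)
    finally show ?thesis using ST by (simp add: R_def S_def T_def)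
  qed
  \<comment> \<open>The shift to \<open>Suc N\<close> matches the trapezoid limit, whose sum over k
    <= N ends with the term of base \<open>Suc N\<close>.\<close>
  have "(\<lambda>N. R (Suc N)) \<longlonglongrightarrow> - Re (zeta (of_real (- a)))"
  proof -
    have "(\<lambda>N. Re ((\<Sum>k\<le>N. of_nat (Suc k) powr (- of_real (- a))) - of_nat (Suc N) powr
        (- of_real (- a)) / 2
           - of_nat (Suc N) powr (1 - of_real (- a)) / (1 - of_real (- a)))) \<longlonglongrightarrow>
               Re (zeta (of_real (- a)))"
      using a by (intro tendsto_Re zeta_trapezoid_LIMSEQ) (auto simp: complex_eq_iff)
    moreover have "Re ((\<Sum>k\<le>N. of_nat (Suc k) powr (- of_real (- a))) - of_nat (Suc N) powr
        (- of_real (- a)) / 2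
           - of_nat (Suc N) powr (1 - of_real (- a)) / (1 - of_real (- a))) = - R (Suc N)" for N
    proof -
      have pw: "(of_nat (Suc k) :: complex) powr of_real b = of_real (real (Suc k) powr b)" for k b
        by (simp add: powr_of_real[symmetric] del: of_nat_Suc)
      have "(\<Sum>k\<le>N. of_nat (Suc k) powr (- of_real (- a))) - of_nat (Suc N) powr
          (- of_real (- a)) / 2
           - of_nat (Suc N) powr (1 - of_real (- a)) / (1 - of_real (- a)) =
               complex_of_real (- R (Suc N))"
        using pw[of _ a] pw[of N "a + 1"]
        by (simp add: R_def lessThan_Suc_atMost add.commute del: of_nat_Suc)
      then show ?thesis by simp
    qed
    ultimately have "(\<lambda>N. - R (Suc N)) \<longlonglongrightarrow> Re (zeta (of_real (- a)))" by simp
    from tendsto_minus[OF this] show ?thesis by simp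
  qed
  note R_lim = this
  then show "Re (zeta (of_real (- a))) \<le> 0"
    using LIMSEQ_le_const[OF R_lim, of 0] P by auto
  have "(\<lambda>N. P (Suc N)) \<longlonglongrightarrow> ennreal (c * - Re (zeta (of_real (- a))))"
    unfolding P[THEN conjunct1] by (intro tendsto_intros R_lim)
  moreover have "(\<lambda>N. P (Suc N)) \<longlonglongrightarrow> (\<integral>\<^sup>+x\<in>{0<..}. ennreal (w x * f x) \<partial>lborel)"
    unfolding P_def
  proof (rule nn_integral_LIMSEQ)
    show "incseq (\<lambda>N x. ennreal (w x * (f x * (1 - exp (- (real (Suc N) * x)))))
        * indicator {0<..} x)"
      using f_nonneg by (auto simp: incseq_def le_fun_def indicator_def intro!: ennreal_leI
          mult_left_mono)
    show "(\<lambda>N. ennreal (w x * (f x * (1 - exp (- (real (Suc N) * x))))) * indicator {0<..} x)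
        \<longlonglongrightarrow> ennreal (w x * f x) * indicator {0<..} x" for x
    proof (cases "x > 0")
      case True
      then have "(\<lambda>N. exp (- (real (Suc N) * x))) \<longlonglongrightarrow> 0" by real_asymp
      then have "(\<lambda>N. ennreal (w x * (f x * (1 - exp (- (real (Suc N) * x)))))) \<longlonglongrightarrow>
          ennreal (w x * (f x * (1 - 0)))"
        by (intro tendsto_intros)
      then show ?thesis using True by simp
    qed simp
  qed measurable
  ultimately have "(\<integral>\<^sup>+x\<in>{0<..}. ennreal (w x * f x) \<partial>lborel) =
      ennreal (c * - Re (zeta (of_real (- a))))"
    using LIMSEQ_unique by blast
  then show "(\<integral>\<^sup>+x\<in>{0<..}. ennreal (x powr (- a - 1) * (1 / (exp x - 1) - 1 / x + 1 / 2)) \<partial>lborel) =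
    ennreal (- Gamma (1 - a) / a * Re (zeta (of_real (- a))))"
    by (simp add: w_def f_def c_def)
qed

section \<open>The functional equation, first on a real segment and then in the plane\<close>

text \<open>Both sides evaluate the same Mellin integral, and both are nonnegative, so the equality
  of their \<open>ennreal\<close> images descends to the reals.\<close>

lemma zeta_functional_equation_real:
  fixes a :: real
  assumes a: "0 < a" "a < 1"
  shows "pi / cos (pi * a / 2) * (2 * pi) powr (- a - 1) * Re (zeta (of_real (1 + a))) =
    - Gamma (1 - a) / a * Re (zeta (of_real (- a)))"
proof -
  have "cos (pi * a / 2) > 0"
    by (rule cos_pi_half_pos[OF a])
  then have "pi / cos (pi * a / 2) * (2 * pi) powr (- a - 1) * Re (zeta (of_real (1 + a))) \<ge> 0"
    using nn_integral_bose_zeta_gt_1(2)[OF a] by auto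
  moreover have "- Gamma (1 - a) / a * Re (zeta (of_real (- a))) \<ge> 0"
    using a nn_integral_bose_zeta_neg(2)[OF a] by (intro mult_nonpos_nonpos) auto
  ultimately show ?thesis
    using nn_integral_bose_zeta_gt_1(1)[OF a] nn_integral_bose_zeta_neg(1)[OF a]
        by (simp only: ennreal_inj)
qed

text \<open>The difference D of the two sides vanishes on the segment (-1, 0) by the real case,
  hence on the connected complement of {0, 1}. With the entire function \<open>rGamma\<close> in
  place of \<open>Gamma\<close>, only the poles of \<open>zeta s\<close> and
  \<open>zeta (1 - s)\<close> have to be removed. As \<open>s * rGamma (1 + s)\<close> is
  \<open>rGamma s\<close>, this is the classical equation.\<close>

lemma zeta_functional_equation:
  assumes s: "s \<noteq> 0" "s \<noteq> 1"
  shows "zeta s * cos (of_real pi * s / 2) =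
    s * of_real pi * of_real (2 * pi) powr (s - 1) * zeta (1 - s) * rGamma (1 + s)"
proof -
  define D where "D s = zeta s * cos (of_real pi * s / 2) -
    s * of_real pi * of_real (2 * pi) powr (s - 1) * zeta (1 - s) * rGamma (1 + s)" for s
  define U where "U = complex_of_real ` {- 1<..<0}"
  have "zeta \<circ> (\<lambda>s. 1 - s) holomorphic_on - {0, 1}"
    by (rule holomorphic_on_compose_gen[OF _ zeta_holomorphic]) (auto intro!: holomorphic_intros)
  then have D_hol: "D holomorphic_on - {0, 1}"
    unfolding D_def by (intro holomorphic_intros holomorphic_on_subset[OF zeta_holomorphic])
        (auto simp: o_def)
  have "D s = 0"
  proof (rule analytic_continuation[OF D_hol])
    show "open (- {0, 1 :: complex})" by (intro open_Compl) auto
    show "connected (- {0, 1 :: complex})"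
      by (intro connected_open_diff_countable[of UNIV, unfolded Compl_eq_Diff_UNIV[symmetric]]) auto
    show "U \<subseteq> - {0, 1}" by (auto simp: U_def)
    show "- 1 / 2 \<in> - {0, 1 :: complex}" by (auto simp: complex_eq_iff)
    \<comment> \<open>Plane neighbourhoods of -1/2 pull back along \<open>complex_of_real\<close> to
      real ones, which contain further points of the interval.\<close>
    show "- 1 / 2 islimpt U"
    proof (rule islimptI)
      fix T :: "complex set" assume T: "- 1 / 2 \<in> T" "open T"
      have "open (complex_of_real -` T)"
        using T by (intro open_vimage continuous_intros) auto
      moreover have "- 1 / 2 \<in> complex_of_real -` T" using T by simp
      moreover have "- 1 / 2 islimpt {- 1<..<0 :: real}"
          by (intro interior_limit_point) (simp add: interior_open)
      ultimately obtain y where y: "y \<in> {- 1<..<0}" "complex_of_real y \<in> T" "y \<noteq> - 1 / 2"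
        unfolding islimpt_def by blast
      have "complex_of_real y \<noteq> of_real (- 1 / 2)"
        using y(3) by (simp only: of_real_eq_iff not_False_eq_True)
      then show "\<exists>y\<in>U. y \<in> T \<and> y \<noteq> - 1 / 2"
        using y by (intro bexI[of _ "complex_of_real y"]) (auto simp: U_def)
    qed
    show "s \<in> - {0, 1}" using s by auto
    fix z assume "z \<in> U"
    then obtain x where x: "z = of_real x" "- 1 < x" "x < 0" by (auto simp: U_def)
    define a where "a = - x"
    have z: "z = of_real (- a)" and a: "0 < a" "a < 1" using x by (auto simp: a_def)
    have cos: "cos (pi * a / 2) > 0"
      by (rule cos_pi_half_pos[OF a])
    have "Gamma (1 - a) \<noteq> 0" using a
        by (metis Gamma_real_pos diff_gt_0_iff_gt less_numeral_extra(3))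
    then have "Re (zeta (of_real (- a))) * cos (pi * a / 2) =
        - a * pi * (2 * pi) powr (- a - 1) * Re (zeta (of_real (1 + a))) * rGamma (1 - a)"
      using zeta_functional_equation_real[OF a] cos a unfolding rGamma_inverse_Gamma
      by (simp add: field_simps)
    then have "complex_of_real (Re (zeta (of_real (- a))) * cos (pi * a / 2)) =
        complex_of_real (- a * pi * (2 * pi) powr (- a - 1) * Re (zeta (of_real (1 + a))) * rGamma
            (1 - a))"
      by (simp only:)
    moreover have "complex_of_real (rGamma (1 - a)) = rGamma (1 + z)"
      by (simp add: z flip: rGamma_complex_of_real)
    moreover have "complex_of_real ((2 * pi) powr (- a - 1)) = of_real (2 * pi) powr (z - 1)"
      using powr_of_real[of "2 * pi" "- a - 1"] by (simp add: z)
    moreover have "complex_of_real (cos (pi * a / 2)) = cos (of_real pi * z / 2)"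
      by (simp add: z flip: cos_of_real)
    moreover have "complex_of_real (Re (zeta (of_real (- a)))) = zeta z"
      unfolding z by (rule zeta_of_real[symmetric])
    moreover have "complex_of_real (Re (zeta (of_real (1 + a)))) = zeta (1 - z)"
      using zeta_of_real[of "1 + a"] by (simp add: z)
    ultimately show "D z = 0"
      unfolding D_def by (simp only: of_real_mult of_real_minus) (simp add: z)
  qed
  then show ?thesis by (simp add: D_def)
qed

section \<open>The critical line\<close>

lemma zeta_log_deriv_functional_equation:
  assumes s: "s \<noteq> 1" "s \<notin> \<int>\<^sub>\<le>\<^sub>0" and cos: "cos (of_real pi * s / 2) \<noteq> 0"
    and nz: "zeta s \<noteq> 0" "zeta (1 - s) \<noteq> 0"
  shows "deriv zeta s / zeta s + deriv zeta (1 - s) / zeta (1 - s) =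
    of_real (ln (2 * pi)) + of_real pi / 2 * tan (of_real pi * s / 2) - Digamma s"
proof -
  have s0: "s \<noteq> 0" using s by auto
  have s1: "1 + s \<notin> \<int>\<^sub>\<le>\<^sub>0" using s by (metis add.commute plus_one_in_nonpos_Ints_imp)
  define L where "L z = zeta z * cos (of_real pi * z / 2)" for z
  define R where "R z =
      z * of_real pi * of_real (2 * pi) powr (z - 1) * zeta (1 - z) * rGamma (1 + z)" for z
  have "(L has_field_derivative deriv zeta s * cos (of_real pi * s / 2)
      - zeta s * (of_real pi / 2) * sin (of_real pi * s / 2)) (at s)"
    unfolding L_def using s
    by (auto intro!: derivative_eq_intros zeta_has_field_derivative simp: algebra_simps)
  then have L': "(L has_field_derivative
      L s * (deriv zeta s / zeta s - of_real pi / 2 * tan (of_real pi * s / 2))) (at s)"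
  proof (rule DERIV_cong)
    show "deriv zeta s * cos (of_real pi * s / 2)
        - zeta s * (of_real pi / 2) * sin (of_real pi * s / 2) =
        L s * (deriv zeta s / zeta s - of_real pi / 2 * tan (of_real pi * s / 2))"
      using nz cos by (simp add: L_def tan_def field_simps)
  qed
  have "((\<lambda>z. zeta (1 - z)) has_field_derivative deriv zeta (1 - s) * - 1) (at s)"
    using s0 by (intro DERIV_chain2[of zeta] zeta_has_field_derivative)
        (auto intro!: derivative_eq_intros)
  then have z1: "((\<lambda>z. zeta (1 - z)) has_field_derivative - deriv zeta (1 - s)) (at s)" by simp
  have "((\<lambda>z. of_real (2 * pi) powr (z - 1)) has_field_derivative
      Ln (of_real (2 * pi)) * of_real (2 * pi) powr (s - 1) * 1) (at s)"
    by (intro DERIV_chain2[OF has_field_derivative_powr_right]) (auto intro!: derivative_eq_intros)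
  moreover have "Ln (of_real (2 * pi)) = of_real (ln (2 * pi))"
    by (rule Ln_of_real) simp
  ultimately have pw: "((\<lambda>z. of_real (2 * pi) powr (z - 1)) has_field_derivative
      of_real (ln (2 * pi)) * of_real (2 * pi) powr (s - 1)) (at s)"
    by (simp only: mult_1_right)
  have rG: "((\<lambda>z. rGamma (1 + z)) has_field_derivative - rGamma (1 + s) * Digamma (1 + s)) (at s)"
    using s1 by (auto intro!: derivative_eq_intros)
  have R': "(R has_field_derivative
      R s * (1 / s + of_real (ln (2 * pi)) - deriv zeta (1 - s) / zeta (1 - s) - Digamma (1 + s)))
      (at s)"
  proof -
    have lin: "((\<lambda>z. z * of_real pi) has_field_derivative of_real pi) (at s)"
      by (auto intro!: derivative_eq_intros)
    show ?thesis
      unfolding R_def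
      by (rule DERIV_cong[OF DERIV_mult[OF DERIV_mult[OF DERIV_mult[OF lin pw] z1] rG]])
        (use s0 nz in \<open>simp add: field_simps\<close>)
  qed
  have "L z = R z" if "z \<in> - {0, 1}" for z
    unfolding L_def R_def using that by (intro zeta_functional_equation) auto
  moreover have "open (- {0, 1 :: complex})" by (intro open_Compl) auto
  ultimately have "(L has_field_derivative
      R s * (1 / s + of_real (ln (2 * pi)) - deriv zeta (1 - s) / zeta (1 - s) - Digamma (1 + s)))
      (at s)"
    using R' s s0 by (subst has_field_derivative_cong_ev[OF refl _ refl refl])
        (auto simp: eventually_nhds intro!: exI[of _ "- {0, 1}"])
  with L' have "L s * (deriv zeta s / zeta s - of_real pi / 2 * tan (of_real pi * s / 2)) =
      R s * (1 / s + of_real (ln (2 * pi)) - deriv zeta (1 - s) / zeta (1 - s) - Digamma (1 + s))"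
    by (rule DERIV_unique)
  moreover have "L s = R s"
    unfolding L_def R_def using s s0 by (intro zeta_functional_equation) auto
  moreover have "L s \<noteq> 0" using nz cos by (simp add: L_def)
  ultimately have "deriv zeta s / zeta s - of_real pi / 2 * tan (of_real pi * s / 2) =
      1 / s + of_real (ln (2 * pi)) - deriv zeta (1 - s) / zeta (1 - s) - Digamma (1 + s)"
    by simp
  \<comment> \<open>This 1/s cancels the one coming from the factor s of the functional
    equation.\<close>
  moreover have "Digamma (1 + s) = Digamma s + 1 / s"
    using Digamma_plus1[OF s0] by (simp add: add.commute)
  ultimately show ?thesis by (simp add: algebra_simps)
qed

section \<open>Growth of Digamma and the resulting bound on the critical line\<close>

text \<open>Subtracting the series at 1/2 from the one at 1/2 + i t leaves, in the real part, a
  series of nonnegative terms \<open>g n\<close>. Those with n < m <= |t| together exceed half the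
  m-th harmonic number, which is unbounded in m.\<close>

lemma filterlim_Re_Digamma_critical_line:
  "filterlim (\<lambda>t. Re (Digamma (1 / 2 + \<i> * of_real t))) at_top at_infinity"
proof (subst filterlim_at_top, rule allI)
  fix B :: real
  have "eventually (\<lambda>m. harm m \<ge> 2 * (B - Re (Digamma (1 / 2)))) sequentially"
    using harm_at_top by (simp add: filterlim_at_top)
  then obtain m where m: "harm m \<ge> 2 * (B - Re (Digamma (1 / 2)))"
    using eventually_happens by fastforce
  have "B \<le> Re (Digamma (1 / 2 + \<i> * of_real t))" if t: "real m \<le> norm t" for t
  proof -
    define s where "s = 1 / 2 + \<i> * complex_of_real t"
    have s0: "s \<noteq> 0" by (simp add: s_def complex_eq_iff)
    define g where "g n = 1 / (n + 1 / 2) - (n + 1 / 2) / ((n + 1 / 2)\<^sup>2 + t\<^sup>2)" for n :: real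
    have g: "g n = t\<^sup>2 / ((n + 1 / 2) * ((n + 1 / 2)\<^sup>2 + t\<^sup>2))" if "n \<ge> 0" for n
    proof -
      define u where "u = n + 1 / 2"
      have "u > 0" "u\<^sup>2 + t\<^sup>2 > 0" using that by (auto simp: u_def intro!: add_pos_nonneg)
      then have "1 / u - u / (u\<^sup>2 + t\<^sup>2) = t\<^sup>2 / (u * (u\<^sup>2 + t\<^sup>2))"
        by (simp add: divide_simps) (simp add: power2_eq_square algebra_simps)
      then show ?thesis by (simp add: g_def u_def)
    qed
    have g0: "g n \<ge> 0" if "n \<ge> 0" for n
      unfolding g[OF that] using that by auto
    have "(\<lambda>m. Re ((of_real (ln (real m)) - (\<Sum>n<m. inverse (s + of_nat n))) -
        (of_real (ln (real m)) - (\<Sum>n<m. inverse (1 / 2 + of_nat n))))) \<longlonglongrightarrow>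
            Re (Digamma s - Digamma (1 / 2))"
      by (intro tendsto_Re tendsto_diff Digamma_LIMSEQ s0) auto
    moreover have "Re ((of_real (ln (real m)) - (\<Sum>n<m. inverse (s + of_nat n))) -
        (of_real (ln (real m)) - (\<Sum>n<m. inverse (1 / 2 + of_nat n)))) = (\<Sum>n<m. g (real n))" for m
    proof -
      have "Re (inverse (1 / 2 + of_nat n)) - Re (inverse (s + of_nat n)) = g (real n)" for n
      proof -
        have "Re (inverse (1 / 2 + of_nat n)) = 1 / (real n + 1 / 2)"
        proof -
          have "inverse (1 / 2 + of_nat n) = complex_of_real (1 / (real n + 1 / 2))"
            by (simp add: inverse_eq_divide add.commute)
          then show ?thesis by (simp only: Re_complex_of_real)
        qed
        moreover have "Re (inverse (s + of_nat n)) = (real n + 1 / 2) / ((real n + 1 / 2)\<^sup>2 + t\<^sup>2)"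
          by (simp add: s_def add.commute)
        ultimately show ?thesis by (simp add: g_def)
      qed
      then show ?thesis by (simp add: sum_subtractf[symmetric])
    qed
    ultimately have lim: "(\<lambda>m. \<Sum>n<m. g (real n)) \<longlonglongrightarrow> Re (Digamma s - Digamma (1 / 2))" by simp
    have "(\<Sum>n<m. g (real n)) \<le> Re (Digamma s - Digamma (1 / 2))"
    proof (rule incseq_le[OF _ lim])
      show "incseq (\<lambda>m. \<Sum>n<m. g (real n))" by (intro incseq_SucI) (simp add: g0)
    qed
    moreover have "harm m / 2 \<le> (\<Sum>n<m. g (real n))"
      unfolding harm_altdef sum_divide_distrib
    proof (rule sum_mono)
      fix n assume n: "n \<in> {..<m}"
      \<comment> \<open>From n < m <= |t| one gets u <= |t|, so the denominator u^2 + t^2 is at most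
        2 t^2 and \<open>g n\<close> is at least 1/(2 u), which dominates 1/(2 (n + 1)).\<close>
      define u where "u = real n + 1 / 2"
      have u: "u > 0" "u \<le> real (Suc n)" "u \<le> \<bar>t\<bar>" using n t by (auto simp: u_def)
      then have ut: "u\<^sup>2 \<le> t\<^sup>2" by (simp add: abs_le_square_iff[symmetric])
      have t2: "t\<^sup>2 > 0" using u by auto
      have "inverse (real (Suc n)) / 2 \<le> 1 / (2 * u)"
        using u by (simp add: field_simps)
      also have "1 / (2 * u) = t\<^sup>2 / (u * (t\<^sup>2 + t\<^sup>2))"
        using u t2 by (simp add: field_simps)
      also have "\<dots> \<le> t\<^sup>2 / (u * (u\<^sup>2 + t\<^sup>2))"
        using u ut t2 by (intro divide_left_mono mult_left_mono mult_pos_pos add_mono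
            add_nonneg_pos) auto
      also have "\<dots> = g (real n)" by (simp add: g u_def)
      finally show "inverse (real (Suc n)) / 2 \<le> g (real n)" .
    qed
    ultimately show ?thesis using m by (simp add: s_def)
  qed
  then show "eventually (\<lambda>t. B \<le> Re (Digamma (1 / 2 + \<i> * of_real t))) at_infinity"
    unfolding eventually_at_infinity by blast
qed

lemma Re_zeta_log_deriv_critical_line:
  fixes t :: real
  defines "s \<equiv> 1 / 2 + \<i> * of_real t"
  assumes nz: "zeta s \<noteq> 0"
  shows "2 * Re (deriv zeta s / zeta s) \<le> ln (2 * pi) + pi / 2 - Re (Digamma s)"
proof -
  have cnj_s: "cnj s = 1 - s" by (simp add: s_def complex_eq_iff)
  have s1: "s \<noteq> 1" by (simp add: s_def complex_eq_iff)
  have s0: "s \<notin> \<int>\<^sub>\<le>\<^sub>0"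
  proof
    assume "s \<in> \<int>\<^sub>\<le>\<^sub>0"
    then have "Re s \<le> 0" by (auto elim!: nonpos_Ints_cases)
    then show False by (simp add: s_def)
  qed
  have zc: "zeta (1 - s) = cnj (zeta s)" unfolding cnj_s[symmetric] by (rule zeta_cnj)
  have dc: "deriv zeta (1 - s) = cnj (deriv zeta s)"
    unfolding cnj_s[symmetric] by (rule deriv_zeta_cnj[OF s1])
  have "sin (of_real pi * s / 2) = cos (of_real pi / 2 - of_real pi * s / 2)"
    by (simp add: cos_diff flip: sin_of_real cos_of_real)
  also have "of_real pi / 2 - of_real pi * s / 2 = cnj (of_real pi * s / 2)"
    by (simp add: cnj_s algebra_simps diff_divide_distrib)
  finally have sin: "sin (of_real pi * s / 2) = cnj (cos (of_real pi * s / 2))"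
    by (simp add: cnj_cos)
  \<comment> \<open>If the cosine vanished, so would its conjugate, the sine, against sin^2 + cos^2
    = 1.\<close>
  have cos: "cos (of_real pi * s / 2) \<noteq> 0"
  proof
    assume "cos (of_real pi * s / 2) = 0"
    with sin sin_cos_squared_add[of "of_real pi * s / 2"] show False by simp
  qed
  have "norm (tan (of_real pi * s / 2)) = 1"
    using cos by (simp add: tan_def norm_divide sin)
  then have "Re (tan (of_real pi * s / 2)) \<le> 1"
    using complex_Re_le_cmod[of "tan (of_real pi * s / 2)"] by simp
  then have "pi / 2 * Re (tan (of_real pi * s / 2)) \<le> pi / 2 * 1"
    by (intro mult_left_mono) auto
  then have tan: "Re (of_real pi / 2 * tan (of_real pi * s / 2)) \<le> pi / 2"
    using Re_complex_of_real by (simp add: Re_divide)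
  have "deriv zeta s / zeta s + cnj (deriv zeta s / zeta s) =
      of_real (ln (2 * pi)) + of_real pi / 2 * tan (of_real pi * s / 2) - Digamma s"
    using zeta_log_deriv_functional_equation[OF s1 s0 cos nz] nz by (simp add: zc dc)
  from arg_cong[OF this, of Re]
  have "2 * Re (deriv zeta s / zeta s) =
      ln (2 * pi) + Re (of_real pi / 2 * tan (of_real pi * s / 2)) - Re (Digamma s)"
    by (simp only: plus_complex.simps minus_complex.simps cnj.simps Re_complex_of_real)
  then show ?thesis using tan by linarith
qed

theorem theorem1:
  shows "closure {(zeta (1 / 2 + \<i> * of_real t), deriv zeta (1 / 2 + \<i> * of_real t)) | t :: real. True}
           \<noteq> (UNIV :: (complex \<times> complex) set)"
proof
  define S where "S = {(zeta (1 / 2 + \<i> * of_real t),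
      deriv zeta (1 / 2 + \<i> * of_real t)) | t :: real. True}"
  assume "closure {(zeta (1 / 2 + \<i> * of_real t),
      deriv zeta (1 / 2 + \<i> * of_real t)) | t :: real. True} = UNIV"
  then have dense: "closure S = UNIV" by (simp add: S_def)
  \<comment> \<open>The 3 makes twice the real part of the logarithmic derivative at most -3 once
    |t| >= T, whereas on the box B below it is at least -2.\<close>
  have "eventually (\<lambda>t. ln (2 * pi) + pi / 2 + 3 \<le>
      Re (Digamma (1 / 2 + \<i> * of_real t))) at_infinity"
    using filterlim_Re_Digamma_critical_line by (simp add: filterlim_at_top)
  then obtain T where T: "\<And>t :: real. T \<le> norm t \<Longrightarrow> ln (2 * pi) + pi / 2 + 3 \<le>
      Re (Digamma (1 / 2 + \<i> * of_real t))"
    unfolding eventually_at_infinity by blast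
  define K where "K = (\<lambda>t. zeta (1 / 2 + \<i> * of_real t)) ` cball 0 T"
  \<comment> \<open>Radius 1/2 in both factors forces |z| > 1/2 > |d| for (z, d) in B, hence |d/z|
    <= 1.\<close>
  define B where "B = ball (1 :: complex) (1 / 2) \<times> ball (0 :: complex) (1 / 2)"
  have ne1: "1 / 2 + \<i> * of_real t \<noteq> 1" for t by (simp add: complex_eq_iff)
  have vd: "((\<lambda>t. zeta (1 / 2 + \<i> * of_real t)) has_vector_derivative
      \<i> * deriv zeta (1 / 2 + \<i> * of_real t)) (at t)" for t
    by (rule field_vector_diff_chain_at[where f = "\<lambda>t. 1 / 2 + \<i> * of_real t", unfolded o_def])
      (use zeta_has_field_derivative[OF ne1] in \<open>auto intro!: derivative_eq_intros\<close>)
  then have diff: "(\<lambda>t. zeta (1 / 2 + \<i> * of_real t)) differentiable_on A" for A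
    by (meson differentiableI_vector differentiable_at_imp_differentiable_on)
  \<comment> \<open>K is the image of a one-dimensional set under a differentiable map into the real
    two-dimensional plane.\<close>
  have "negligible K"
    unfolding K_def by (intro negligible_differentiable_image_lowdim diff) auto
  have "closed K"
    unfolding K_def
    by (intro compact_imp_closed compact_continuous_image differentiable_imp_continuous_on diff)
        auto
  have "B \<inter> S \<subseteq> K \<times> UNIV"
  proof
    fix p assume p: "p \<in> B \<inter> S"
    then obtain t where t: "p = (zeta (1 / 2 + \<i> * of_real t), deriv zeta (1 / 2 + \<i> * of_real t))"
      by (auto simp: S_def)
    define z d where "z = fst p" and "d = snd p"
    have z: "norm (1 - z) < 1 / 2" and d: "norm d < 1 / 2"
      using p by (auto simp: B_def z_def d_def dist_norm)
    have z2: "norm z > 1 / 2"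
      using norm_triangle_ineq[of "1 - z" z] z by simp
    have "norm (d / z) \<le> 1"
      using z2 d by (simp add: norm_divide divide_simps)
    then have "Re (d / z) \<ge> - 1"
      using abs_Re_le_cmod[of "d / z"] by linarith
    moreover have "2 * Re (d / z) \<le> ln (2 * pi) + pi / 2 - Re (Digamma (1 / 2 + \<i> * of_real t))"
    proof -
      have "z \<noteq> 0" using z2 by auto
      then show ?thesis
        using Re_zeta_log_deriv_critical_line[of t] unfolding z_def d_def t fst_conv snd_conv
        by blast
    qed
    ultimately have "\<not> T \<le> norm t" using T[of t] by linarith
    then have "z \<in> K" by (auto simp: K_def z_def t)
    then show "p \<in> K \<times> UNIV" by (auto simp: z_def mem_Times_iff)
  qed
  \<comment> \<open>K is compact, so the cylinder over it is closed. As B is open and S is assumed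
    dense, all of B lies in that cylinder; its slice at second coordinate 0 puts a disc of positive
    measure inside the null set K.\<close>
  then have "closure (B \<inter> S) \<subseteq> K \<times> UNIV"
    using \<open>closed K\<close> by (intro closure_minimal closed_Times) auto
  moreover have "B \<inter> closure S \<subseteq> closure (B \<inter> S)"
    by (intro open_Int_closure_subset) (auto simp: B_def intro: open_Times)
  ultimately have "B \<subseteq> K \<times> UNIV" using dense by auto
  have "ball 1 (1 / 2) \<subseteq> K"
  proof
    fix x :: complex assume "x \<in> ball 1 (1 / 2)"
    then have "(x, 0) \<in> B" by (simp add: B_def)
    then show "x \<in> K" using \<open>B \<subseteq> K \<times> UNIV\<close> by blast
  qed
  then have "negligible (ball (1 :: complex) (1 / 2))"
    using \<open>negligible K\<close> negligible_subset by blast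
  then show False
    by (simp add: negligible_convex_interior)
qed

end
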